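(* Let $D>1$ be a square-free integer and let $k$ be a negative integer relatively prime to $D$. Then the quartic equation $$X^2 - D Y^4 = k$$ has at most $$384 \cdot 2^{\omega(k)}\, \epsilon_{D}^{3/2} \sqrt{|k|/(2D)}$$ solutions in positive integers $X$ and $Y$.
   Context: For a positive non-square integer $D$, $\epsilon_D = T + U\sqrt{D}$ (with $T,U$ positive integers) denotes the minimal unit greater than $1$ in the ring $\mathbb{Z}[\sqrt{D}]$. For a nonzero integer $k$, $\omega(k)$ denotes the number of distinct prime factors of $k$. *)

theory Defs
  imports Complex_Main "HOL-Computational_Algebra.Computational_Algebra"
begin

text \<open>The ring \<open>\<int>[\<surd>D]\<close>, realised as a subring of the real numbers.\<close>
definition Zsqrt :: "int \<Rightarrow> real set" where
  "Zsqrt D = {of_int a + of_int b * sqrt (of_int D) | a b. True}"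

definition Zsqrt_units :: "int \<Rightarrow> real set" where
  "Zsqrt_units D = {x \<in> Zsqrt D. \<exists>y \<in> Zsqrt D. x * y = 1}"

text \<open>
  Units of norm \<open>-1\<close> are allowed. For positive non-square \<open>D\<close> the minimum exists, and
  it has the form \<open>T + U\<surd>D\<close> with \<open>T\<close> and \<open>U\<close> positive; for other \<open>D\<close> the value is
  meaningless.
\<close>
definition fund_unit :: "int \<Rightarrow> real" where
  "fund_unit D = (LEAST x. x \<in> Zsqrt_units D \<and> x > 1)"

definition omega :: "int \<Rightarrow> nat" where
  "omega k = card (prime_factors k)"

end

theory Submission
  imports Defs "HOL-Analysis.Kronecker_Approximation_Theorem" "HOL-Number_Theory.Cong"
    "HOL-Real_Asymp.Real_Asymp"
begin

text \<open>
  Put \<open>N = -k\<close>. Call two solutions of \<open>X\<^sup>2 + N = D Y\<^sup>4\<close> related if the quotient of the numbers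
  \<open>X + Y\<^sup>2 \<surd>D\<close> is \<open>u\<^sup>2\<close>, with \<open>u\<close> a unit of norm \<open>1\<close>. Then
  \<open>(X\<^sub>1 + \<i>\<surd>N) (X\<^sub>2 - \<i>\<surd>N) / D\<close> is a square in \<open>\<int>[\<i>\<surd>N]\<close>, and its fourth root \<open>\<kappa>\<close> has
  absolute value squared \<open>Y\<^sub>1 Y\<^sub>2\<close>. Hence for every \<open>A\<close> in \<open>\<int>[\<i>\<surd>N]\<close> the square of \<open>2 Im (A \<kappa>)\<close> is an
  integer, and \<open>2 Im (A \<kappa>)\<close> is either zero or at least \<open>1\<close> in absolute value. Taking \<open>A = 1\<close>
  gives a cubic gap principle between related solutions. Taking for \<open>A\<close> the values at
  \<open>X\<^sub>1 + \<i>\<surd>N\<close> of the Pade approximants of the fourth root shows that a solution beyond \<open>N\<^sup>2\<close> has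
  no related solution that is a very high power of it. So a class of related large solutions has
  \<open>O(N\<^bsup>1/6\<^esup>)\<close> members, where the crude exponent pays for the gaps needed to reach \<open>N\<^sup>2\<close>.

  A class is determined by \<open>h = gcd X Y\<^sup>2\<close> with \<open>h\<^sup>2\<close> dividing \<open>N\<close>, by a square root of \<open>D\<close> modulo
  \<open>N / h\<^sup>2\<close>, and by the exponent modulo \<open>4\<close> of the fundamental unit. This makes \<open>O(2\<^bsup>\<omega>(k)\<^esup> N\<^bsup>1/3\<^esup>)\<close>
  classes. The solutions with \<open>Y \<le> 100 \<surd>N\<close> are counted trivially, and \<open>\<epsilon>\<^sup>3 \<ge> 2 D\<close> turns the resulting
  multiple of \<open>2\<^bsup>\<omega>(k)\<^esup> \<surd>N\<close> into the stated bound.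
\<close>

section \<open>Pade approximants of the fourth root\<close>

text \<open>The interpolation polynomial \<open>q\<close> through the \<open>card S\<close> nodes
  equals \<open>p\<close>, whose degree is too small for a term of degree \<open>card S - 1\<close>.
  The sum is the coefficient of that term in the Lagrange form.\<close>

lemma lagrange_leading_coeff_zero:
  fixes y :: "'i \<Rightarrow> 'a::field"
  assumes "finite S" "inj_on y S" "degree p + 1 < card S"
  shows "(\<Sum>i\<in>S. poly p (y i) / (\<Prod>j\<in>S - {i}. y i - y j)) = 0"
proof -
  define L where "L = (\<lambda>i. \<Prod>j\<in>S - {i}. [:- y j, 1:])"
  define w where "w = (\<lambda>i. \<Prod>j\<in>S - {i}. y i - y j)"
  define q where "q = (\<Sum>i\<in>S. smult (poly p (y i) / w i) (L i))"
  have degL: "degree (L i) = card S - 1" if "i \<in> S" for i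
    unfolding L_def using assms(1) that by (subst degree_prod_eq_sum_degree) auto
  have lcL: "coeff (L i) (card S - 1) = 1" if "i \<in> S" for i
  proof -
    have "lead_coeff (L i) = (\<Prod>j\<in>S - {i}. lead_coeff [:- y j, 1:])"
      unfolding L_def by (rule lead_coeff_prod)
    thus ?thesis using degL[OF that] by simp
  qed
  have w0: "w i \<noteq> 0" if "i \<in> S" for i
    unfolding w_def using assms(1,2) that by (auto simp: inj_on_def)
  have polyL: "poly (L i) (y k) = (if k = i then w i else 0)" if "i \<in> S" "k \<in> S" for i k
    using that assms(1) by (auto simp: L_def w_def poly_prod intro!: prod_zero)
  have "poly q (y k) = poly p (y k)" if "k \<in> S" for k
  proof -
    have "poly q (y k) = (\<Sum>i\<in>S. if k = i then poly p (y k) else 0)"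
      unfolding q_def poly_sum by (rule sum.cong) (use that w0 polyL in auto)
    thus ?thesis using that assms(1) by simp
  qed
  moreover have "degree q < card S"
  proof -
    have "degree q \<le> card S - 1"
      unfolding q_def by (rule degree_sum_le[OF assms(1)]) (use degL in \<open>auto intro: order.trans[OF degree_smult_le]\<close>)
    thus ?thesis using assms(3) by simp
  qed
  ultimately have "q = p"
    by (intro poly_eqI_degree[of "y ` S"]) (use assms in \<open>auto simp: card_image\<close>)
  hence "coeff q (card S - 1) = 0"
    using assms(3) by (auto intro: coeff_eq_0)
  moreover have "coeff q (card S - 1) = (\<Sum>i\<in>S. poly p (y i) / w i)"
    unfolding q_def coeff_sum by (rule sum.cong) (use lcL in auto)
  ultimately show ?thesis unfolding w_def by simp
qed

text \<open>
  With \<open>\<nu> = 1/4\<close> the approximant is \<open>\<Sum>r\<le>n. pade_coeff n r * w ^ r\<close>. On the unit circle, approximating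
  \<open>w powr \<nu>\<close> to order \<open>2 n + 1\<close> at \<open>w = 1\<close> means that the sine polynomial \<open>pade_sin n\<close> vanishes to that order
  at \<open>0\<close>, i.e. that the odd moments of the frequencies below \<open>2 n\<close> vanish. Up to a factor independent
  of \<open>r\<close>, \<open>pade_coeff n r * pade_freq n r\<close> is the Lagrange weight at the node \<open>(pade_freq n r)\<^sup>2\<close>.
\<close>
definition pade_coeff :: "nat \<Rightarrow> nat \<Rightarrow> real" where
  "pade_coeff n r = ((of_nat n + 1/4) gchoose (n - r)) * ((of_nat n - 1/4) gchoose r)"

definition pade_freq :: "nat \<Rightarrow> nat \<Rightarrow> real" where
  "pade_freq n r = 2 * of_nat r - of_nat n + 1/4"

text \<open>The right-hand side is independent of \<open>r\<close>. This yields the positivity of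
  the coefficients and, later, their identification with Lagrange weights.\<close>

lemma pade_coeff_pochhammer:
  assumes "r \<le> n"
  shows "pade_coeff n r * (pochhammer (5/4) r * pochhammer (3/4) (n - r) * fact r * fact (n - r))
           = pochhammer (5/4) n * pochhammer (3/4) n"
proof -
  have 1: "((of_nat n + 1/4 :: real) gchoose (n - r)) * fact (n - r) = pochhammer (5/4 + of_nat r) (n - r)"
    using assms by (simp add: gbinomial_pochhammer' of_nat_diff algebra_simps)
  have 2: "((of_nat n - 1/4 :: real) gchoose r) * fact r = pochhammer (3/4 + of_nat (n - r)) r"
    using assms by (simp add: gbinomial_pochhammer' of_nat_diff algebra_simps)
  have 3: "pochhammer (5/4::real) n = pochhammer (5/4) r * pochhammer (5/4 + of_nat r) (n - r)"
    using assms by (rule pochhammer_product)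
  have 4: "pochhammer (3/4::real) n = pochhammer (3/4) (n - r) * pochhammer (3/4 + of_nat (n - r)) r"
    using pochhammer_product[of "n - r" n "3/4::real"] assms by simp
  show ?thesis unfolding pade_coeff_def 3 4 1[symmetric] 2[symmetric] by (simp only: mult_ac)
qed

lemma pade_coeff_pos:
  assumes "r \<le> n" shows "pade_coeff n r > 0"
proof -
  have "pochhammer (5/4::real) n * pochhammer (3/4) n > 0"
    by (intro mult_pos_pos pochhammer_pos) auto
  moreover have "pochhammer (5/4::real) r * pochhammer (3/4) (n - r) * fact r * fact (n - r) > 0"
    by (intro mult_pos_pos pochhammer_pos) auto
  ultimately show ?thesis
    unfolding pade_coeff_pochhammer[OF assms, symmetric] by (simp add: zero_less_mult_iff)
qed

text \<open>In the Vandermonde convolution the shifts \<open>1/4\<close> and \<open>-1/4\<close>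
  cancel, which leaves a central binomial coefficient.\<close>

lemma sum_pade_coeff_le: "(\<Sum>r\<le>n. pade_coeff n r) \<le> 4 ^ n"
proof -
  have "(\<Sum>r\<le>n. pade_coeff n r) = (\<Sum>k=0..n. ((of_nat n - 1/4) gchoose k) * ((of_nat n + 1/4) gchoose (n - k)))"
    unfolding pade_coeff_def atMost_atLeast0 by (simp add: mult.commute)
  also have "\<dots> = (of_nat n - 1/4 + (of_nat n + 1/4)) gchoose n"
    by (rule gbinomial_Vandermonde)
  also have "\<dots> = of_nat ((2 * n) choose n)"
    by (simp add: binomial_gbinomial)
  also have "\<dots> \<le> of_nat (2 ^ (2 * n))"
    by (subst of_nat_le_iff) (rule binomial_le_pow2)
  finally show ?thesis by (simp add: power_mult)
qed

text \<open>The factors form a rising factorial of length \<open>n + 1\<close> starting at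
  \<open>1/4 - (n - r)\<close>. It is cut at \<open>1/4\<close>, and the \<open>n - r\<close>
  negative factors are reflected.\<close>

lemma pade_freq_pochhammer:
  assumes "r \<le> n"
  shows "(\<Prod>s\<le>n. of_nat r + of_nat s - of_nat n + 1/4)
          = (-1) ^ (n - r) * (1/4) * pochhammer (5/4::real) r * pochhammer (3/4) (n - r)"
proof -
  have "(\<Prod>s\<le>n. of_nat r + of_nat s - of_nat n + 1/4 :: real) = (\<Prod>s=0..<Suc n. (1/4 - of_nat (n - r)) + of_nat s)"
    using assms by (intro prod.cong) (auto simp: of_nat_diff)
  also have "\<dots> = pochhammer (1/4 - of_nat (n - r)) (Suc n)"
    by (simp only: pochhammer_prod)
  also have "Suc n = (n - r) + Suc r" using assms by simp
  also have "pochhammer (1/4 - of_nat (n - r) :: real) ((n - r) + Suc r)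
      = pochhammer (1/4 - of_nat (n - r)) (n - r) * pochhammer (1/4) (Suc r)"
    by (simp only: pochhammer_product' diff_add_cancel)
  also have "pochhammer (1/4 - of_nat (n - r) :: real) (n - r) = (-1) ^ (n - r) * pochhammer (3/4) (n - r)"
    using pochhammer_minus[of "-1/4 + of_nat (n - r) :: real" "n - r"] by simp
  also have "pochhammer (1/4::real) (Suc r) = 1/4 * pochhammer (5/4) r"
    by (simp add: pochhammer_rec)
  finally show ?thesis by (simp add: mult_ac)
qed

lemma prod_diff_index:
  assumes "r \<le> n"
  shows "(\<Prod>s\<in>{..n} - {r}. of_nat r - of_nat s :: real) = (-1) ^ (n - r) * fact r * fact (n - r)"
proof -
  have "{..n} - {r} = {..<r} \<union> {r<..n}" using assms by auto
  hence "(\<Prod>s\<in>{..n} - {r}. of_nat r - of_nat s :: real) = (\<Prod>s\<in>{..<r} \<union> {r<..n}. of_nat r - of_nat s)"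
    by (rule arg_cong)
  also have "\<dots> = (\<Prod>s<r. of_nat r - of_nat s) * (\<Prod>s\<in>{r<..n}. of_nat r - of_nat s)"
    by (rule prod.union_disjoint) auto
  also have "(\<Prod>s<r. of_nat r - of_nat s :: real) = (\<Prod>i\<in>{1..r}. of_nat i)"
    by (rule prod.reindex_bij_witness[of _ "\<lambda>i. r - i" "\<lambda>i. r - i"]) (auto simp: of_nat_diff)
  also have "\<dots> = fact r" by (simp add: fact_prod)
  also have "(\<Prod>s\<in>{r<..n}. of_nat r - of_nat s :: real) = (\<Prod>i\<in>{1..n-r}. - of_nat i)"
    by (rule prod.reindex_bij_witness[of _ "\<lambda>i. r + i" "\<lambda>s. s - r"]) (auto simp: of_nat_diff)
  also have "\<dots> = (-1) ^ (n - r) * fact (n - r)"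
    by (simp add: prod_uminus fact_prod)
  finally show ?thesis by (simp add: mult_ac)
qed

text \<open>A difference of squares splits into \<open>r - s\<close> and
  \<open>r + s - n + 1/4\<close>, up to the factor \<open>4\<close>. Here
  \<open>pade_freq n r\<close> is the missing second factor for \<open>s = r\<close>; with it, both
  products cancel the symbols in \<open>pade_coeff_pochhammer\<close>.\<close>

lemma pade_coeff_lagrange:
  assumes "r \<le> n"
  shows "pade_coeff n r * pade_freq n r * (\<Prod>s\<in>{..n} - {r}. (pade_freq n r)\<^sup>2 - (pade_freq n s)\<^sup>2)
          = 4 ^ n * (1/4) * pochhammer (5/4) n * pochhammer (3/4) n"
proof -
  have eq: "(pade_freq n r)\<^sup>2 - (pade_freq n s)\<^sup>2 = 4 * (of_nat r - of_nat s) * (of_nat r + of_nat s - of_nat n + 1/4)" for s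
    by (simp add: pade_freq_def power2_eq_square field_simps)
  have "pade_freq n r * (\<Prod>s\<in>{..n} - {r}. (pade_freq n r)\<^sup>2 - (pade_freq n s)\<^sup>2)
      = 4 ^ n * (\<Prod>s\<in>{..n} - {r}. of_nat r - of_nat s) * (pade_freq n r * (\<Prod>s\<in>{..n} - {r}. of_nat r + of_nat s - of_nat n + 1/4))"
    unfolding eq prod.distrib using assms by simp
  also have "pade_freq n r * (\<Prod>s\<in>{..n} - {r}. of_nat r + of_nat s - of_nat n + 1/4)
      = (\<Prod>s\<le>n. of_nat r + of_nat s - of_nat n + 1/4)"
    using assms by (subst prod.remove[of "{..n}" r]) (auto simp: pade_freq_def)
  finally have "pade_freq n r * (\<Prod>s\<in>{..n} - {r}. (pade_freq n r)\<^sup>2 - (pade_freq n s)\<^sup>2)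
      = 4 ^ n * (1/4) * (((-1) ^ (n - r)) * ((-1) ^ (n - r))) * (pochhammer (5/4) r * pochhammer (3/4) (n - r) * fact r * fact (n - r))"
    unfolding prod_diff_index[OF assms] pade_freq_pochhammer[OF assms] by (simp only: mult_ac)
  also have "((-1) ^ (n - r)) * ((-1) ^ (n - r)) = (1::real)"
    by (simp flip: power_add)
  finally show ?thesis
    using pade_coeff_pochhammer[OF assms] by (simp only: mult_ac mult_1_right) (simp add: mult_ac)
qed

text \<open>Up to the constant \<open>K\<close> this is the Lagrange sum of the monomial of degree
  \<open>j\<close> at \<open>n + 1\<close> nodes.\<close>

lemma pade_moment_zero:
  assumes "j < n"
  shows "(\<Sum>r\<le>n. pade_coeff n r * pade_freq n r ^ (2 * j + 1)) = 0"
proof -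
  define K :: real where "K = 4 ^ n * (1/4) * pochhammer (5/4) n * pochhammer (3/4) n"
  define y where "y = (\<lambda>r. (pade_freq n r)\<^sup>2)"
  have K: "K > 0" unfolding K_def by (intro mult_pos_pos pochhammer_pos) auto
  \<comment> \<open>The nonzero right-hand side of \<open>pade_coeff_lagrange\<close> excludes
    coinciding nodes.\<close>
  have inj: "inj_on y {..n}"
  proof (rule inj_onI)
    fix r s assume rs: "r \<in> {..n}" "s \<in> {..n}" "y r = y s"
    show "r = s"
    proof (rule ccontr)
      assume "r \<noteq> s"
      have "(\<Prod>s\<in>{..n} - {r}. y r - y s) = 0" using \<open>r \<noteq> s\<close> rs by (intro prod_zero) auto
      moreover have "pade_coeff n r * pade_freq n r * (\<Prod>s\<in>{..n} - {r}. y r - y s) = K"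
        using pade_coeff_lagrange[of r n] rs(1) unfolding y_def K_def by blast
      ultimately show False using K by (simp only: mult_zero_right less_irrefl)
    qed
  qed
  have "(\<Sum>r\<le>n. poly (monom 1 j) (y r) / (\<Prod>s\<in>{..n} - {r}. y r - y s)) = 0"
    by (rule lagrange_leading_coeff_zero) (use inj assms in \<open>auto simp: degree_monom_eq\<close>)
  also have "(\<Sum>r\<le>n. poly (monom 1 j) (y r) / (\<Prod>s\<in>{..n} - {r}. y r - y s))
     = (\<Sum>r\<le>n. pade_coeff n r * pade_freq n r ^ (2 * j + 1) / K)"
  proof (rule sum.cong)
    fix r assume "r \<in> {..n}"
    hence "pade_coeff n r * pade_freq n r * (\<Prod>s\<in>{..n} - {r}. y r - y s) = K"
      using pade_coeff_lagrange[of r n] by (simp add: y_def K_def)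
    moreover from this K have "(\<Prod>s\<in>{..n} - {r}. y r - y s) \<noteq> 0" by (metis less_irrefl mult_zero_right)
    ultimately show "poly (monom 1 j) (y r) / (\<Prod>s\<in>{..n} - {r}. y r - y s) = pade_coeff n r * pade_freq n r ^ (2 * j + 1) / K"
      using K by (simp add: field_simps poly_monom y_def flip: power_mult)
  qed simp
  also have "\<dots> = (\<Sum>r\<le>n. pade_coeff n r * pade_freq n r ^ (2 * j + 1)) / K"
    by (simp add: sum_divide_distrib)
  finally show ?thesis using K by simp
qed

lemma pade_freq_abs_le: "r \<le> n \<Longrightarrow> \<bar>pade_freq n r\<bar> \<le> of_nat n + 1"
  by (auto simp: pade_freq_def abs_le_iff)

section \<open>Order of vanishing of the sine polynomial\<close>

definition pade_sin :: "nat \<Rightarrow> real \<Rightarrow> real" where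
  "pade_sin n \<theta> = (\<Sum>r\<le>n. pade_coeff n r * sin (pade_freq n r * \<theta>))"

text \<open>In the Taylor series the even powers are absent and the odd ones below
  \<open>2 * n + 1\<close> have zero moments. The rest is dominated by the series of
  \<open>exp (n + 1)\<close>, because the frequencies are at most \<open>n + 1\<close> in absolute
  value.\<close>

lemma pade_sin_bound:
  assumes "\<bar>\<theta>\<bar> \<le> 1"
  shows "\<bar>pade_sin n \<theta>\<bar> \<le> 4 ^ n * exp (of_nat n + 1) * \<bar>\<theta>\<bar> ^ (2 * n + 1)"
proof -
  define f where "f = (\<lambda>k. sin_coeff k * \<theta> ^ k * (\<Sum>r\<le>n. pade_coeff n r * pade_freq n r ^ k))"
  define g :: "nat \<Rightarrow> real" where "g = (\<lambda>k. 4 ^ n * \<bar>\<theta>\<bar> ^ (2 * n + 1) * ((of_nat n + 1) ^ k /\<^sub>R fact k))"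
  have "(\<lambda>k. \<Sum>r\<le>n. pade_coeff n r * (sin_coeff k *\<^sub>R (pade_freq n r * \<theta>) ^ k)) sums
          (\<Sum>r\<le>n. pade_coeff n r * sin (pade_freq n r * \<theta>))"
    by (intro sums_sum sums_mult sin_converges)
  also have "(\<lambda>k. \<Sum>r\<le>n. pade_coeff n r * (sin_coeff k *\<^sub>R (pade_freq n r * \<theta>) ^ k)) = f"
    by (simp add: f_def fun_eq_iff sum_distrib_left power_mult_distrib mult_ac)
  finally have f: "f sums pade_sin n \<theta>" by (simp add: pade_sin_def)
  have g: "g sums (4 ^ n * \<bar>\<theta>\<bar> ^ (2 * n + 1) * exp (of_nat n + 1))"
    unfolding g_def by (intro sums_mult exp_converges)
  have fg: "norm (f k) \<le> g k" for k
  proof (cases "even k \<or> k < 2 * n")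
    case True
    have "f k = 0"
    proof (cases "even k")
      case False
      then obtain j where "k = 2 * j + 1" by (elim oddE)
      thus ?thesis using True pade_moment_zero[of j n] by (simp add: f_def)
    qed (simp add: f_def sin_coeff_def)
    thus ?thesis by (simp add: g_def)
  next
    case False
    hence k: "2 * n + 1 \<le> k" by (cases "k = 2 * n") auto
    have "\<bar>\<Sum>r\<le>n. pade_coeff n r * pade_freq n r ^ k\<bar> \<le> (\<Sum>r\<le>n. pade_coeff n r * (of_nat n + 1) ^ k)"
      by (rule order.trans[OF sum_abs])
         (auto intro!: sum_mono mult_mono power_mono simp: abs_mult power_abs pade_freq_abs_le less_imp_le[OF pade_coeff_pos] abs_of_pos[OF pade_coeff_pos])
    also have "\<dots> \<le> 4 ^ n * (of_nat n + 1) ^ k"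
      unfolding sum_distrib_right[symmetric] by (intro mult_right_mono sum_pade_coeff_le) auto
    finally have 1: "\<bar>\<Sum>r\<le>n. pade_coeff n r * pade_freq n r ^ k\<bar> \<le> 4 ^ n * (of_nat n + 1) ^ k" .
    have 2: "\<bar>\<theta>\<bar> ^ k \<le> \<bar>\<theta>\<bar> ^ (2 * n + 1)" using k assms by (intro power_decreasing) auto
    have 3: "\<bar>sin_coeff k\<bar> \<le> inverse (fact k)" by (simp add: sin_coeff_def divide_inverse abs_mult)
    have "norm (f k) = \<bar>sin_coeff k\<bar> * \<bar>\<theta>\<bar> ^ k * \<bar>\<Sum>r\<le>n. pade_coeff n r * pade_freq n r ^ k\<bar>"
      by (simp add: f_def abs_mult power_abs)
    also have "\<dots> \<le> inverse (fact k) * \<bar>\<theta>\<bar> ^ (2 * n + 1) * (4 ^ n * (of_nat n + 1) ^ k)"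
      using 1 2 3 by (intro mult_mono) auto
    also have "\<dots> = g k" by (simp add: g_def mult_ac)
    finally show ?thesis .
  qed
  have "norm (suminf f) \<le> suminf g"
    using fg g by (intro norm_suminf_le) (auto simp: sums_iff)
  thus ?thesis using f g by (simp add: sums_iff mult_ac)
qed

text \<open>This is the approximant at \<open>cis (2 * \<theta>)\<close>, turned by
  \<open>cis (- n * \<theta>)\<close>, so that complex conjugation corresponds to reversing the
  coefficients.\<close>

definition pade_sum :: "nat \<Rightarrow> real \<Rightarrow> complex" where
  "pade_sum n \<theta> = (\<Sum>r\<le>n. of_real (pade_coeff n r) * cis ((2 * of_nat r - of_nat n) * \<theta>))"

lemma pade_sum_cis: "pade_sum n \<theta> * cis (\<theta> / 4) = (\<Sum>r\<le>n. of_real (pade_coeff n r) * cis (pade_freq n r * \<theta>))"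
  unfolding pade_sum_def sum_distrib_right
  by (rule sum.cong) (simp_all add: pade_freq_def cis_mult mult.assoc ring_distribs)

lemma Im_pade_sum_cis: "Im (pade_sum n \<theta> * cis (\<theta> / 4)) = pade_sin n \<theta>"
  unfolding pade_sum_cis pade_sin_def by simp

lemma norm_pade_sum_le: "norm (pade_sum n \<theta>) \<le> 4 ^ n"
proof -
  have "norm (pade_sum n \<theta>) \<le> (\<Sum>r\<le>n. pade_coeff n r)"
    unfolding pade_sum_def
    by (rule sum_norm_le) (simp add: norm_mult abs_of_pos[OF pade_coeff_pos])
  thus ?thesis using sum_pade_coeff_le[of n] by linarith
qed

lemma Im_mult_cis_le:
  assumes "norm z \<le> c"
  shows "\<bar>Im (z * cis (- \<phi>))\<bar> \<le> \<bar>Im z\<bar> + c * \<bar>\<phi>\<bar>"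
proof -
  have "\<bar>Im (z * cis (- \<phi>))\<bar> \<le> \<bar>Im z * cos \<phi>\<bar> + \<bar>Re z * sin \<phi>\<bar>" by simp
  also have "\<dots> \<le> \<bar>Im z\<bar> * 1 + c * \<bar>\<phi>\<bar>"
    unfolding abs_mult
    by (intro add_mono mult_mono abs_sin_le_one abs_cos_le_one abs_sin_x_le_abs_x)
       (use abs_Re_le_cmod[of z] assms in auto)
  finally show ?thesis by simp
qed

section \<open>The cross determinant of consecutive approximants\<close>

definition pade_poly :: "nat \<Rightarrow> complex poly" where
  "pade_poly n = (\<Sum>r\<le>n. monom (of_real (pade_coeff n r)) r)"

definition pade_poly_rev :: "nat \<Rightarrow> complex poly" where
  "pade_poly_rev n = (\<Sum>r\<le>n. monom (of_real (pade_coeff n r)) (n - r))"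

text \<open>By \<open>poly_pade_det\<close> its zeros on the unit circle are the points where
  \<open>pade_sum n \<theta>\<close> and \<open>pade_sum (Suc n) \<theta>\<close> are linearly
  dependent over the reals.\<close>

definition pade_det :: "nat \<Rightarrow> complex poly" where
  "pade_det n = pade_poly n * pade_poly_rev (Suc n) - pade_poly_rev n * pade_poly (Suc n)"

lemma degree_pade_det: "degree (pade_det n) \<le> 2 * n + 1"
proof -
  have a: "degree (pade_poly n) \<le> n" "degree (pade_poly_rev n) \<le> n" for n
    unfolding pade_poly_def pade_poly_rev_def
    by (auto intro!: degree_sum_le order.trans[OF degree_monom_le])
  show ?thesis unfolding pade_det_def
    by (rule degree_diff_le; rule order.trans[OF degree_mult_le])
       (use a[of n] a[of "Suc n"] in auto)
qed

lemma poly_pade_poly: "poly (pade_poly n) (cis (2 * \<theta>)) = cis (n * \<theta>) * pade_sum n \<theta>"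
  unfolding pade_poly_def pade_sum_def poly_sum sum_distrib_left poly_monom
  by (rule sum.cong) (simp_all add: Complex.DeMoivre cis_mult ring_distribs mult_ac)

lemma poly_pade_poly_rev: "poly (pade_poly_rev n) (cis (2 * \<theta>)) = cis (n * \<theta>) * cnj (pade_sum n \<theta>)"
  unfolding pade_poly_rev_def pade_sum_def poly_sum sum_distrib_left poly_monom cnj_sum
  by (rule sum.cong) (simp_all add: Complex.DeMoivre cis_mult cis_cnj of_nat_diff ring_distribs mult_ac)

lemma poly_pade_det:
  "poly (pade_det n) (cis (2 * \<theta>)) =
     cis (of_nat (2 * n + 1) * \<theta>) * (2 * \<i> * of_real (Im (pade_sum n \<theta> * cnj (pade_sum (Suc n) \<theta>))))"
proof -
  have "poly (pade_det n) (cis (2 * \<theta>)) = (cis (n * \<theta>) * cis (Suc n * \<theta>)) *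
     (pade_sum n \<theta> * cnj (pade_sum (Suc n) \<theta>) - cnj (pade_sum n \<theta>) * pade_sum (Suc n) \<theta>)"
    unfolding pade_det_def poly_diff poly_mult poly_pade_poly poly_pade_poly_rev by (simp add: algebra_simps)
  also have "cis (n * \<theta>) * cis (Suc n * \<theta>) = cis (of_nat (2 * n + 1) * \<theta>)"
    by (simp add: cis_mult algebra_simps)
  also have "pade_sum n \<theta> * cnj (pade_sum (Suc n) \<theta>) - cnj (pade_sum n \<theta>) * pade_sum (Suc n) \<theta>
    = 2 * \<i> * of_real (Im (pade_sum n \<theta> * cnj (pade_sum (Suc n) \<theta>)))"
    by (simp add: complex_eq_iff)
  finally show ?thesis .
qed

text \<open>The constant term suffices: its two products differ by having \<open>3/4 + n\<close> in
  one and \<open>5/4 + n\<close> in the other.\<close>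

lemma pade_det_nonzero: "pade_det n \<noteq> 0"
proof
  have c0: "pade_coeff n 0 = pochhammer (5/4) n / fact n" for n
    using pade_coeff_pochhammer[of 0 n] pochhammer_pos[of "3/4::real" n] by (simp add: field_simps)
  have cn: "pade_coeff n n = pochhammer (3/4) n / fact n" for n
    using pade_coeff_pochhammer[of n n] pochhammer_pos[of "5/4::real" n] by (simp add: field_simps)
  have p0: "poly (pade_poly n) 0 = of_real (pade_coeff n 0)" for n
    unfolding pade_poly_def poly_sum poly_monom by (subst sum.remove[of _ 0]) (auto simp: zero_power)
  have pn: "poly (pade_poly_rev n) 0 = of_real (pade_coeff n n)" for n
    unfolding pade_poly_rev_def poly_sum poly_monom by (subst sum.remove[of _ n]) (auto simp: zero_power)
  assume "pade_det n = 0"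
  hence "poly (pade_det n) 0 = 0" by simp
  hence "of_real (pade_coeff n 0 * pade_coeff (Suc n) (Suc n) - pade_coeff n n * pade_coeff (Suc n) 0) = (0::complex)"
    by (simp add: pade_det_def p0 pn)
  hence "pade_coeff n 0 * pade_coeff (Suc n) (Suc n) = pade_coeff n n * pade_coeff (Suc n) 0"
    unfolding of_real_eq_0_iff by simp
  hence "pochhammer (5/4::real) n * pochhammer (3/4::real) n * (3/4 + n) / (fact n * ((1 + of_nat n) * fact n))
       = pochhammer (5/4::real) n * pochhammer (3/4::real) n * (5/4 + n) / (fact n * ((1 + of_nat n) * fact n))"
    unfolding c0 cn pochhammer_Suc by (simp add: mult_ac)
  hence "pochhammer (5/4::real) n * pochhammer (3/4::real) n * (3/4 + n) = pochhammer (5/4::real) n * pochhammer (3/4::real) n * (5/4 + n)"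
    unfolding divide_cancel_right by (simp add: add_nonneg_eq_0_iff)
  moreover have "pochhammer (5/4::real) n * pochhammer (3/4::real) n > 0"
    by (intro mult_pos_pos pochhammer_pos) auto
  ultimately have "3/4 + real n = 5/4 + real n"
    using mult_left_cancel[of "pochhammer (5/4::real) n * pochhammer (3/4::real) n"] by (metis less_irrefl)
  thus False by simp
qed

text \<open>Turning both sums by \<open>cis (\<theta> / 4)\<close> does not affect the product with
  the conjugate. Afterwards both imaginary parts are sine polynomials, hence small, and the real
  parts are bounded.\<close>

lemma Im_pade_sum_mult_cnj_bound:
  obtains K where "K \<ge> 0" "\<And>\<theta>. 0 < \<theta> \<Longrightarrow> \<theta> \<le> 1 \<Longrightarrow>
    \<bar>Im (pade_sum n \<theta> * cnj (pade_sum (Suc n) \<theta>))\<bar> \<le> K * \<theta> ^ (2 * n + 1)"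
proof
  define K :: real where "K = 4 ^ n * exp (of_nat n + 1) * 4 ^ Suc n + 4 ^ n * (4 ^ Suc n * exp (of_nat (Suc n) + 1))"
  show "K \<ge> 0" unfolding K_def by (intro add_nonneg_nonneg mult_nonneg_nonneg) auto
  fix \<theta> :: real assume t: "0 < \<theta>" "\<theta> \<le> 1"
  define z where "z = (\<lambda>n. pade_sum n \<theta> * cis (\<theta> / 4))"
  have Re: "\<bar>Re (z n)\<bar> \<le> 4 ^ n" for n
    using abs_Re_le_cmod[of "z n"] norm_pade_sum_le[of n \<theta>] by (simp add: z_def norm_mult)
  have Im: "\<bar>Im (z n)\<bar> \<le> 4 ^ n * exp (of_nat n + 1) * \<theta> ^ (2 * n + 1)" for n
    using pade_sin_bound[of \<theta> n] t unfolding z_def Im_pade_sum_cis by simp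
  have "\<theta> ^ (2 * Suc n + 1) \<le> \<theta> ^ (2 * n + 1)"
    using t by (intro power_decreasing) auto
  hence Im': "\<bar>Im (z (Suc n))\<bar> \<le> 4 ^ Suc n * exp (of_nat (Suc n) + 1) * \<theta> ^ (2 * n + 1)"
    by (intro order.trans[OF Im] mult_left_mono) auto
  have "pade_sum n \<theta> * cnj (pade_sum (Suc n) \<theta>) = z n * cnj (z (Suc n)) "
    by (simp add: z_def cis_cnj cis_mult mult_ac)
  hence "\<bar>Im (pade_sum n \<theta> * cnj (pade_sum (Suc n) \<theta>))\<bar> \<le> \<bar>Im (z n) * Re (z (Suc n))\<bar> + \<bar>Re (z n) * Im (z (Suc n))\<bar>"
    by simp
  also have "\<dots> \<le> 4 ^ n * exp (of_nat n + 1) * \<theta> ^ (2 * n + 1) * 4 ^ Suc n + 4 ^ n * (4 ^ Suc n * exp (of_nat (Suc n) + 1) * \<theta> ^ (2 * n + 1))"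
    unfolding abs_mult by (intro add_mono mult_mono Re Im Im') (use t in auto)
  also have "\<dots> = K * \<theta> ^ (2 * n + 1)" by (simp add: K_def algebra_simps)
  finally show "\<bar>Im (pade_sum n \<theta> * cnj (pade_sum (Suc n) \<theta>))\<bar> \<le> K * \<theta> ^ (2 * n + 1)" .
qed

lemma cis_double_minus_1: "cis (2 * \<theta>) - 1 = 2 * \<i> * of_real (sin \<theta>) * cis \<theta>"
  by (simp add: complex_eq_iff cos_double_sin sin_double power2_eq_square)

text \<open>\<open>pade_det n\<close> vanishes at \<open>1\<close> to order at least
  \<open>2 * n + 1\<close> and has at most this degree. So it is a nonzero constant times a power of
  \<open>x - 1\<close> and has no other zero.\<close>

lemma Im_pade_sum_mult_cnj_nonzero:
  assumes "0 < \<theta>" "\<theta> < pi"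
  shows "Im (pade_sum n \<theta> * cnj (pade_sum (Suc n) \<theta>)) \<noteq> 0"
proof
  assume "Im (pade_sum n \<theta> * cnj (pade_sum (Suc n) \<theta>)) = 0"
  hence zero: "poly (pade_det n) (cis (2 * \<theta>)) = 0" by (simp add: poly_pade_det)
  define m where "m = order 1 (pade_det n)"
  obtain q where q: "pade_det n = [:-1, 1:] ^ m * q" "\<not> [:-1, 1:] dvd q"
    using order_decomp[OF pade_det_nonzero[of n], of 1] unfolding m_def by blast
  have q1: "poly q 1 \<noteq> 0" using q(2) by (simp add: poly_eq_0_iff_dvd)
  have "2 * n + 1 \<le> m"
  proof (rule ccontr)
    assume "\<not> 2 * n + 1 \<le> m"
    hence m: "m \<le> 2 * n" by simp
    obtain K where K: "K \<ge> 0" "\<And>\<theta>. 0 < \<theta> \<Longrightarrow> \<theta> \<le> 1 \<Longrightarrow>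
      \<bar>Im (pade_sum n \<theta> * cnj (pade_sum (Suc n) \<theta>))\<bar> \<le> K * \<theta> ^ (2 * n + 1)"
      using Im_pade_sum_mult_cnj_bound[of n] by blast
    \<comment> \<open>If \<open>m \<le> 2 * n\<close>, a factor \<open>t\<close> survives the
      division by \<open>t ^ m\<close>, so the left side tends to \<open>0\<close>. Its limit is
      also \<open>2 ^ m * norm (poly q 1)\<close>, which is not zero.\<close>
    have ev: "norm ((2 * (sin t / t)) ^ m * norm (poly q (cis (2 * t)))) \<le> 2 * K * t" if t: "0 < t" "t \<le> 1" for t
    proof -
      have n1: "norm (cis (2 * t) - 1) = 2 * \<bar>sin t\<bar>"
        unfolding cis_double_minus_1 by (simp add: norm_mult)
      have "norm (poly (pade_det n) (cis (2 * t))) \<le> 2 * K * t ^ (2 * n + 1)"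
        unfolding poly_pade_det norm_mult norm_of_real using K(2)[OF t] by simp
      also have "\<dots> \<le> 2 * K * t ^ (m + 1)"
        using t m K(1) by (intro mult_left_mono power_decreasing) auto
      also have "poly (pade_det n) (cis (2 * t)) = (cis (2 * t) - 1) ^ m * poly q (cis (2 * t))"
        by (simp add: q(1) poly_power)
      finally have "(2 * \<bar>sin t\<bar>) ^ m * norm (poly q (cis (2 * t))) \<le> 2 * K * t * t ^ m"
        unfolding norm_mult norm_power n1 by (simp only: mult_ac power_Suc Suc_eq_plus1[symmetric])
      thus ?thesis using t by (simp add: abs_mult power_divide field_simps power_abs power_mult_distrib)
    qed
    have "((\<lambda>t::real. 2 * K * t) \<longlongrightarrow> 0) (at_right 0)"
      by (auto intro!: tendsto_eq_intros)
    hence "((\<lambda>t. (2 * (sin t / t)) ^ m * norm (poly q (cis (2 * t)))) \<longlongrightarrow> 0) (at_right 0)"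
      by (rule Lim_null_comparison[rotated])
         (use ev in \<open>auto intro!: eventually_at_rightI[of 0 1]\<close>)
    moreover have "((\<lambda>t::real. sin t / t) \<longlongrightarrow> 1) (at_right 0)" by real_asymp
    hence "((\<lambda>t. (2 * (sin t / t)) ^ m * norm (poly q (cis (2 * t)))) \<longlongrightarrow> (2 * 1) ^ m * norm (poly q (cis (2 * 0)))) (at_right 0)"
      by (intro tendsto_intros tendsto_poly)
    ultimately have "(2 * 1) ^ m * norm (poly q (cis (2 * 0))) = 0"
      using tendsto_unique[of "at_right (0::real)"] by fastforce
    thus False using q1 by simp
  qed
  moreover have "q \<noteq> 0" using q1 by auto
  hence "degree (pade_det n) = m + degree q"
    unfolding q(1) by (subst degree_mult_eq) (auto simp: degree_linear_power)
  ultimately have "degree q = 0" using degree_pade_det[of n] by linarith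
  then obtain c where c: "q = [:c:]" by (elim degree_eq_zeroE)
  have "cis (2 * \<theta>) - 1 \<noteq> 0"
    unfolding cis_double_minus_1 using sin_gt_zero[OF assms] by simp
  thus False using zero q1 by (simp add: q(1) c poly_power)
qed

section \<open>Denominators of the coefficients\<close>

lemma fact_two_part:
  obtains e Q :: nat where "fact n = 2 ^ e * Q" "odd Q" "e \<le> n"
proof -
  have "\<exists>e Q :: nat. fact n = 2 ^ e * Q \<and> odd Q \<and> e \<le> n"
  proof (induction n rule: less_induct)
    case (less n)
    \<comment> \<open>The even factors of \<open>fact (2 * k)\<close> give
      \<open>2 ^ k * fact k\<close>, the odd ones give \<open>R\<close>. So the exponent of two is
      \<open>k\<close> plus the one for \<open>fact k\<close>, at most \<open>2 * k\<close>.\<close>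
    have dbl: "\<exists>R::nat. fact (2 * k) = 2 ^ k * fact k * R \<and> odd R" for k
    proof (induction k)
      case (Suc k)
      then obtain R :: nat where R: "fact (2 * k) = 2 ^ k * fact k * R" "odd R" by blast
      have "fact (2 * Suc k) = (2 * k + 2) * ((2 * k + 1) * fact (2 * k) :: nat)"
        by simp
      also have "\<dots> = 2 ^ Suc k * fact (Suc k) * ((2 * k + 1) * R)"
        unfolding R by (simp add: algebra_simps)
      finally show ?case using R(2) by (intro exI[of _ "(2 * k + 1) * R"]) auto
    qed (auto intro: exI[of _ 1])
    show ?case
    proof (cases "n = 0")
      case True
      thus ?thesis by (intro exI[of _ 0] exI[of _ 1]) auto
    next
      case False
      define k where "k = n div 2"
      obtain R :: nat where R: "fact (2 * k) = 2 ^ k * fact k * R" "odd R" using dbl by blast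
      have "k < n" using False by (simp add: k_def)
      then obtain e Q :: nat where eQ: "fact k = 2 ^ e * Q" "odd Q" "e \<le> k" using less by blast
      have f: "fact (2 * k) = 2 ^ (k + e) * (Q * R)" unfolding R eQ by (simp add: power_add mult_ac)
      show ?thesis
      proof (cases "even n")
        case True
        hence "n = 2 * k" by (simp add: k_def)
        thus ?thesis using f eQ R by (intro exI[of _ "k + e"] exI[of _ "Q * R"]) auto
      next
        case False
        hence n: "n = Suc (2 * k)" by (simp add: k_def)
        have "fact n = 2 ^ (k + e) * ((2 * k + 1) * (Q * R))"
          unfolding n fact_Suc f by (simp add: algebra_simps)
        thus ?thesis using eQ R n by (intro exI[of _ "k + e"] exI[of _ "(2 * k + 1) * (Q * R)"]) auto
      qed
    qed
  qed
  thus ?thesis using that by blast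
qed

text \<open>\<open>4 ^ r\<close> clears the quarters and \<open>2 ^ r\<close> the power of two in
  \<open>fact r\<close>. Modulo the odd part \<open>Q\<close> of \<open>fact r\<close> the number
  \<open>4\<close> is invertible, so the product of the \<open>m - 4 * i\<close> is congruent to
  \<open>4 ^ r\<close> times a product of \<open>r\<close> consecutive integers, which
  \<open>fact r\<close> divides.\<close>

lemma gbinomial_quarter_integral:
  fixes m :: int
  shows "8 ^ r * ((of_int m / 4 :: real) gchoose r) \<in> \<int>"
proof -
  obtain e Q :: nat where eQ: "fact r = 2 ^ e * Q" "odd Q" "e \<le> r" by (rule fact_two_part)
  have "coprime (4::int) (int Q)"
  proof -
    have "coprime ((2::int) ^ 2) (int Q)"
      using eQ(2) by (subst coprime_power_left_iff) auto
    thus ?thesis by simp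
  qed
  then obtain s where s: "[4 * s = m] (mod int Q)"
  proof -
    obtain x where "[4 * x = 1] (mod int Q)"
      using cong_solve_coprime_int[OF \<open>coprime 4 (int Q)\<close>] by blast
    from cong_scalar_left[OF this, of m] that[of "m * x"] show ?thesis by (simp add: mult_ac)
  qed
  define P :: int where "P = (\<Prod>i=0..<r. m - 4 * int i)"
  have "[(\<Prod>i=0..<r. 4 * s - 4 * int i) = P] (mod int Q)"
    unfolding P_def by (rule cong_prod) (rule cong_diff[OF s cong_refl])
  also have "(\<Prod>i=0..<r. 4 * s - 4 * int i) = 4 ^ r * (\<Prod>i=0..<r. s - int i)"
    unfolding right_diff_distrib[symmetric] prod.distrib by simp
  finally have "[4 ^ r * (\<Prod>i=0..<r. s - int i) = P] (mod int Q)" .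
  moreover have "int Q dvd (\<Prod>i=0..<r. s - int i)"
  proof -
    have "int Q dvd int (fact r)" unfolding eQ(1) by simp
    hence "int Q dvd fact r" by simp
    also have "fact r dvd (\<Prod>i=0..<r. s - int i)"
      unfolding falling_fact_pochhammer' by (rule fact_dvd_pochhammer)
    finally show ?thesis .
  qed
  ultimately have "int Q dvd P" using cong_dvd_iff dvd_mult by blast
  then obtain c where c: "P = int Q * c" by (elim dvdE)
  have fr: "(fact r :: real) = 2 ^ e * real Q"
    using arg_cong[OF eQ(1), of real] by simp
  have Q0: "real Q > 0" using eQ(2) by (auto intro: odd_pos)
  have "(of_int m / 4 :: real) gchoose r = (\<Prod>i=0..<r. of_int m / 4 - of_nat i) / fact r"
    by (simp add: gbinomial_prod_rev)
  also have "(\<Prod>i=0..<r. of_int m / 4 - of_nat i :: real) = (\<Prod>i=0..<r. of_int (m - 4 * int i) / 4)"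
    by (intro prod.cong) (auto simp: field_simps)
  also have "\<dots> = of_int P / 4 ^ r" by (simp add: P_def prod_dividef)
  finally have "8 ^ r * ((of_int m / 4 :: real) gchoose r) = 2 ^ r * of_int c / 2 ^ e"
    unfolding fr c using Q0 power_mult_distrib[of 2 "4::real" r] by (simp add: field_simps)
  also have "\<dots> = of_int (2 ^ (r - e) * c)"
    using eQ(3) power_diff[of "2::real" e r] by simp
  finally show ?thesis by (simp only: Ints_of_int)
qed

lemma pade_coeff_integral:
  assumes "r \<le> n" shows "8 ^ n * pade_coeff n r \<in> \<int>"
proof -
  have "8 ^ n * pade_coeff n r = (8 ^ (n - r) * ((of_int (4 * int n + 1) / 4 :: real) gchoose (n - r)))
      * (8 ^ r * ((of_int (4 * int n - 1) / 4 :: real) gchoose r))"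
    using assms by (simp add: pade_coeff_def add_divide_distrib diff_divide_distrib power_diff)
  thus ?thesis by (simp only: Ints_mult gbinomial_quarter_integral)
qed

section \<open>Pairs of related solutions\<close>

definition imag_order :: "int \<Rightarrow> complex set" where
  "imag_order N = {Complex (of_int p) (of_int q * sqrt (of_int N)) | p q. True}"

lemma imag_order_of_int [simp, intro]: "of_int p \<in> imag_order N"
  unfolding imag_order_def by (auto intro!: exI[of _ p] exI[of _ 0] simp: complex_eq_iff)

lemma imag_order_add: "x \<in> imag_order N \<Longrightarrow> y \<in> imag_order N \<Longrightarrow> x + y \<in> imag_order N"
  unfolding imag_order_def
proof clarify
  fix p q p' q'
  show "\<exists>r s. Complex (of_int p) (of_int q * sqrt (of_int N)) + Complex (of_int p') (of_int q' * sqrt (of_int N)) =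
      Complex (of_int r) (of_int s * sqrt (of_int N)) \<and> True"
    by (intro exI[of _ "p + p'"] exI[of _ "q + q'"]) (simp add: complex_eq_iff algebra_simps)
qed

lemma imag_order_mult:
  assumes "x \<in> imag_order N" "y \<in> imag_order N" "N \<ge> 0"
  shows "x * y \<in> imag_order N"
proof -
  obtain p q p' q' where "x = Complex (of_int p) (of_int q * sqrt (of_int N))"
     "y = Complex (of_int p') (of_int q' * sqrt (of_int N))"
    using assms(1,2) unfolding imag_order_def by blast
  hence "x * y = Complex (of_int (p * p' - q * q' * N)) (of_int (p * q' + q * p') * sqrt (of_int N))"
    using assms(3) by (simp add: complex_eq_iff algebra_simps)
  thus ?thesis unfolding imag_order_def by blast
qed

lemma imag_order_power: "x \<in> imag_order N \<Longrightarrow> N \<ge> 0 \<Longrightarrow> x ^ n \<in> imag_order N"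
  using imag_order_of_int[of 1 N] by (induction n) (auto intro: imag_order_mult)

lemma imag_order_sum: "(\<And>i. i \<in> I \<Longrightarrow> f i \<in> imag_order N) \<Longrightarrow> sum f I \<in> imag_order N"
  using imag_order_of_int[of 0 N] by (induction I rule: infinite_finite_induct) (auto intro: imag_order_add)

lemma imag_order_Re: "x \<in> imag_order N \<Longrightarrow> Re x \<in> \<int>"
  unfolding imag_order_def by auto

lemma imag_order_norm_sq:
  assumes "x \<in> imag_order N" "N \<ge> 0"
  shows "(norm x)\<^sup>2 \<in> \<int>"
proof -
  obtain p q where "x = Complex (of_int p) (of_int q * sqrt (of_int N))"
    using assms(1) unfolding imag_order_def by blast
  hence "(norm x)\<^sup>2 = of_int (p\<^sup>2 + q\<^sup>2 * N)"
    using assms(2) by (simp add: cmod_power2 power_mult_distrib)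
  thus ?thesis by (simp only: Ints_of_int)
qed

lemma arctan_le_self:
  assumes "x \<ge> 0" shows "arctan x \<le> x"
proof -
  have "0 - arctan 0 \<le> x - arctan x"
  proof (rule DERIV_nonneg_imp_nondecreasing[OF assms], intro exI conjI)
    fix t :: real
    show "((\<lambda>x. x - arctan x) has_real_derivative 1 - inverse (1 + t\<^sup>2)) (at t)"
      by (auto intro!: derivative_eq_intros)
    show "0 \<le> 1 - inverse (1 + t\<^sup>2)" by (simp add: inverse_le_1_iff)
  qed
  thus ?thesis by simp
qed

lemma polar_form:
  fixes D N X Y :: int
  assumes "D > 0" "N > 0" "X > 0" "Y > 0" "X ^ 2 + N = D * Y ^ 4"
  shows "Complex (of_int X) (sqrt (of_int N)) =
     of_real (sqrt (of_int D) * of_int Y ^ 2) * cis (arctan (sqrt (of_int N) / of_int X))"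
proof -
  define x :: real where "x = of_int X"
  define s where "s = sqrt (of_int N)"
  define \<rho> where "\<rho> = sqrt (of_int D) * of_int Y ^ 2"
  have pos: "x > 0" "s > 0" "\<rho> > 0" using assms by (auto simp: x_def s_def \<rho>_def)
  have "\<rho> ^ 2 = of_int (D * Y ^ 4)"
    using assms(1) by (simp add: \<rho>_def power_mult_distrib flip: power_mult)
  also have "\<dots> = x ^ 2 + s ^ 2"
    unfolding assms(5)[symmetric] x_def s_def using assms(2) by simp
  finally have "\<rho> ^ 2 = x ^ 2 + s ^ 2" .
  hence "1 + (s / x)\<^sup>2 = (\<rho> / x) ^ 2"
    using pos by (simp add: power_divide field_simps)
  hence sq: "sqrt (1 + (s / x)\<^sup>2) = \<rho> / x" using pos by (simp add: real_sqrt_unique)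
  show ?thesis
    using pos unfolding x_def[symmetric] s_def[symmetric] \<rho>_def[symmetric]
    by (simp add: complex_eq_iff cos_arctan sin_arctan sq)
qed

text \<open>\<open>X2_eq\<close> is the rational part of \<open>X2 + Y2\<^sup>2 \<surd>D = (a + b
  \<surd>D)\<^sup>2 (X1 + Y1\<^sup>2 \<surd>D)\<close>. The assumption \<open>N_le\<close> keeps the
  arguments of \<open>X1 + \<i> s\<close> and \<open>X2 + \<i> s\<close> at most
  \<open>1\<close>.\<close>

locale solution_pair =
  fixes D N X1 Y1 X2 Y2 a b :: int
  assumes D: "D > 0" and N: "N > 0" and X1: "X1 > 0" and Y1: "Y1 > 0" and Y2: "Y2 > 0"
    and a: "a > 0" and b: "b > 0" and unit: "a ^ 2 - D * b ^ 2 = 1"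
    and sol1: "X1 ^ 2 + N = D * Y1 ^ 4" and sol2: "X2 ^ 2 + N = D * Y2 ^ 4"
    and X2_eq: "X2 = X1 * (a ^ 2 + D * b ^ 2) + 2 * a * b * D * Y1 ^ 2"
    and N_le: "N \<le> X1"
begin

definition s :: real where "s = sqrt (of_int N)"
definition \<rho>1 :: real where "\<rho>1 = sqrt (of_int D) * of_int Y1 ^ 2"
definition \<rho>2 :: real where "\<rho>2 = sqrt (of_int D) * of_int Y2 ^ 2"
definition \<theta>1 :: real where "\<theta>1 = arctan (s / of_int X1)"
definition \<theta>2 :: real where "\<theta>2 = arctan (s / of_int X2)"
definition M :: real where "M = of_int Y1 * of_int Y2"
text \<open>\<open>v\<close> is the coefficient of \<open>\<surd>D\<close> in
  \<open>(a + b \<surd>D) (X1 + Y1\<^sup>2 \<surd>D)\<close>.\<close>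

definition v :: int where "v = X1 * b + Y1 ^ 2 * a"
definition \<kappa> :: complex where "\<kappa> = of_real (sqrt M) * cis ((\<theta>1 - \<theta>2) / 4)"
text \<open>The factor \<open>8 ^ n\<close> clears the denominators and \<open>\<rho>1 ^ n\<close>
  homogenises: \<open>A n\<close> is an integral form of degree \<open>n\<close> in
  \<open>X1 + \<i> s\<close> and its conjugate.\<close>

definition A :: "nat \<Rightarrow> complex" where "A n = of_real ((8 * \<rho>1) ^ n) * pade_sum n \<theta>1"

lemma X2_diff: "X2 - X1 = 2 * D * b * v"
proof -
  have "X2 - X1 = X1 * (a ^ 2 - D * b ^ 2 - 1) + 2 * D * b * v"
    unfolding X2_eq v_def by (simp add: algebra_simps power2_eq_square)
  thus ?thesis using unit by simp
qed

lemma v_pos: "v > 0" unfolding v_def using X1 Y1 a b by (simp add: add_pos_pos)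

lemma X2_gt: "X2 > X1" 
proof -
  have "2 * D * b * v > 0" using D b v_pos by simp
  thus ?thesis using X2_diff by linarith
qed

lemma X2: "X2 > 0" using X2_gt X1 by simp

lemma s_pos: "s > 0" using N by (simp add: s_def)
lemma s_sq: "s ^ 2 = of_int N" using N by (simp add: s_def)
lemma \<rho>1_pos: "\<rho>1 > 0" and \<rho>2_pos: "\<rho>2 > 0"
  using D Y1 Y2 by (auto simp: \<rho>1_def \<rho>2_def)
lemma M_pos: "M > 0" using Y1 Y2 by (simp add: M_def)

lemma \<rho>_prod: "\<rho>1 * \<rho>2 = of_int D * M ^ 2"
proof -
  have "\<rho>1 * \<rho>2 = (sqrt (of_int D) * sqrt (of_int D)) * M ^ 2"
    unfolding \<rho>1_def \<rho>2_def M_def by (simp add: power_mult_distrib mult_ac)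
  thus ?thesis using D by simp
qed

lemma polar1: "Complex (of_int X1) s = of_real \<rho>1 * cis \<theta>1"
  unfolding s_def \<rho>1_def \<theta>1_def using polar_form[OF D N X1 Y1 sol1] .

lemma polar2: "Complex (of_int X2) s = of_real \<rho>2 * cis \<theta>2"
  unfolding s_def \<rho>2_def \<theta>2_def using polar_form[OF D N X2 Y2 sol2] .

lemma angle_bound:
  fixes X :: int
  assumes "X \<ge> X1" "Complex (of_int X) s = of_real \<rho> * cis \<theta>" "\<theta> = arctan (s / of_int X)" "\<rho> > 0"
  shows "\<theta> > 0" "\<theta> \<le> 1" "\<theta> \<le> 2 * s / \<rho>"
proof -
  define x :: real where "x = of_int X"
  have x: "x > 0" using assms X1 by (simp add: x_def)
  show "\<theta> > 0" using x s_pos assms(3) by (simp add: x_def)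
  have N1: "real_of_int N \<ge> 1" using N by simp
  have "s ^ 2 \<le> (of_int N) ^ 2" unfolding s_sq using N1 by (simp add: power2_eq_square)
  hence "s \<le> of_int N" using N by (simp add: power2_le_iff_abs_le)
  also have "\<dots> \<le> x" using N_le assms(1) by (simp add: x_def)
  finally have sx: "s \<le> x" .
  have le: "\<theta> \<le> s / x" unfolding assms(3) x_def[symmetric] using x s_pos by (intro arctan_le_self) auto
  moreover have "s / x \<le> 1" using sx x by simp
  ultimately show "\<theta> \<le> 1" by linarith
  have "\<rho> = norm (Complex (of_int X) s)" unfolding assms(2) using assms(4) by (simp add: norm_mult)
  also have "\<dots> \<le> x + s" using cmod_le[of "Complex (of_int X) s"] x s_pos by (simp add: x_def)
  also have "\<dots> \<le> 2 * x" using sx by simp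
  finally have "s / x \<le> 2 * s / \<rho>" using x assms(4) s_pos by (simp add: field_simps)
  thus "\<theta> \<le> 2 * s / \<rho>" using le by linarith
qed

lemmas \<theta>1_bounds = angle_bound[OF order.refl polar1 \<theta>1_def \<rho>1_pos]
lemmas \<theta>2_bounds = angle_bound[OF less_imp_le[OF X2_gt] polar2 \<theta>2_def \<rho>2_pos]

lemma \<theta>_less: "\<theta>2 < \<theta>1"
  unfolding \<theta>1_def \<theta>2_def arctan_less_iff
  using X1 X2_gt s_pos by (intro divide_strict_left_mono) auto

text \<open>By the Pell equation \<open>D\<close> times the square of the right-hand side is
  \<open>(X1 + \<i> s) (X2 - \<i> s)\<close>; by the polar forms the same holds for the left-hand
  side. Both sides have positive real part, which settles the sign.\<close>

lemma \<gamma>_eq: "of_real M * cis ((\<theta>1 - \<theta>2) / 2) = Complex (of_int v) (of_int b * s)"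
proof -
  define g where "g = Complex (of_int v) (of_int b * s)"
  define w where "w = of_real M * cis ((\<theta>1 - \<theta>2) / 2)"
  have re: "D * (v ^ 2 - N * b ^ 2) = X1 * X2 + N"
  proof -
    have "D * (v ^ 2 - N * b ^ 2) - (X1 * X2 + N)
       = (D * Y1 ^ 4 - (X1 ^ 2 + N)) * a ^ 2 + N * (a ^ 2 - D * b ^ 2 - 1)"
      unfolding X2_eq v_def by (simp add: algebra_simps power2_eq_square power4_eq_xxxx)
    thus ?thesis using unit sol1 by simp
  qed
  have "of_int D * g ^ 2 = Complex (of_int X1) s * cnj (Complex (of_int X2) s)"
  proof (rule complex_eqI)
    have "Re (of_int D * g ^ 2) = of_int (D * (v ^ 2 - N * b ^ 2))"
      by (simp add: g_def power2_eq_square algebra_simps flip: s_sq)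
    thus "Re (of_int D * g ^ 2) = Re (Complex (of_int X1) s * cnj (Complex (of_int X2) s))"
      unfolding re by (simp add: power2_eq_square flip: s_sq)
    have "Im (of_int D * g ^ 2) = s * of_int (2 * D * b * v)"
      by (simp add: g_def power2_eq_square algebra_simps)
    thus "Im (of_int D * g ^ 2) = Im (Complex (of_int X1) s * cnj (Complex (of_int X2) s))"
      unfolding X2_diff[symmetric] by (simp add: algebra_simps)
  qed
  also have "\<dots> = of_real (\<rho>1 * \<rho>2) * cis (\<theta>1 - \<theta>2)"
    unfolding polar1 polar2 by (simp add: cis_cnj cis_mult mult_ac)
  also have "\<dots> = of_int D * w ^ 2"
  proof -
    have "cis ((\<theta>1 - \<theta>2) / 2) ^ 2 = cis (\<theta>1 - \<theta>2)"
      unfolding Complex.DeMoivre by (rule arg_cong[of _ _ cis]) (simp add: field_simps)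
    thus ?thesis unfolding \<rho>_prod w_def by (simp add: power_mult_distrib)
  qed
  finally have "g ^ 2 = w ^ 2" using D by simp
  hence "g = w \<or> g = - w" by (simp add: power2_eq_iff)
  moreover have "Re w > 0"
    unfolding w_def using M_pos \<theta>_less \<theta>1_bounds \<theta>2_bounds pi_gt3
    by (simp add: cos_gt_zero_pi)
  moreover have "Re g > 0" using v_pos by (simp add: g_def)
  ultimately have "g = w" by auto
  thus ?thesis by (simp add: g_def w_def)
qed

lemma \<kappa>_sq: "\<kappa> ^ 2 = Complex (of_int v) (of_int b * s)"
proof -
  have "cis ((\<theta>1 - \<theta>2) / 4) ^ 2 = cis ((\<theta>1 - \<theta>2) / 2)"
    unfolding Complex.DeMoivre by (rule arg_cong[of _ _ cis]) (simp add: field_simps)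
  moreover have "of_real (sqrt M) ^ 2 = (of_real M :: complex)"
    using M_pos by (simp flip: of_real_power)
  ultimately show ?thesis unfolding \<gamma>_eq[symmetric] \<kappa>_def by (simp add: power_mult_distrib)
qed

lemma A_lattice: "A n \<in> imag_order N"
proof -
  have x: "Complex (of_int X1) s \<in> imag_order N" "Complex (of_int X1) (- s) \<in> imag_order N"
    unfolding imag_order_def s_def
    by (auto intro: exI[of _ X1] exI[of _ "1::int"] exI[of _ "-1::int"])
  have cnj: "Complex (of_int X1) (- s) = of_real \<rho>1 * cis (- \<theta>1)"
  proof -
    have "Complex (of_int X1) (- s) = cnj (Complex (of_int X1) s)" by (simp add: complex_eq_iff)
    also have "\<dots> = cnj (of_real \<rho>1 * cis \<theta>1)" by (simp only: polar1)
    also have "\<dots> = of_real \<rho>1 * cis (- \<theta>1)" by (simp add: cis_cnj)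
    finally show ?thesis .
  qed
  have "A n = (\<Sum>r\<le>n. of_real (8 ^ n * pade_coeff n r) * (Complex (of_int X1) s ^ r * Complex (of_int X1) (- s) ^ (n - r)))"
    unfolding A_def pade_sum_def sum_distrib_left
  proof (rule sum.cong)
    fix r assume r: "r \<in> {..n}"
    have "\<rho>1 ^ n = \<rho>1 ^ r * \<rho>1 ^ (n - r)" using r by (simp flip: power_add)
    moreover have "cis ((2 * of_nat r - of_nat n) * \<theta>1) = cis \<theta>1 ^ r * cis (- \<theta>1) ^ (n - r)"
      using r by (simp add: Complex.DeMoivre cis_mult of_nat_diff algebra_simps)
    ultimately show "of_real ((8 * \<rho>1) ^ n) * (of_real (pade_coeff n r) * cis ((2 * of_nat r - of_nat n) * \<theta>1))
      = of_real (8 ^ n * pade_coeff n r) * (Complex (of_int X1) s ^ r * Complex (of_int X1) (- s) ^ (n - r))"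
      unfolding polar1 cnj by (simp add: power_mult_distrib mult_ac)
  qed simp
  also have "\<dots> \<in> imag_order N"
  proof (rule imag_order_sum)
    fix r assume "r \<in> {..n}"
    then obtain z :: int where "8 ^ n * pade_coeff n r = of_int z"
      using pade_coeff_integral[of r n] by (auto elim: Ints_cases)
    hence z: "of_real (8 ^ n * pade_coeff n r) = (of_int z :: complex)" by simp
    show "of_real (8 ^ n * pade_coeff n r) * (Complex (of_int X1) s ^ r * Complex (of_int X1) (- s) ^ (n - r)) \<in> imag_order N"
      unfolding z using N by (intro imag_order_mult imag_order_power x) auto
  qed
  finally show ?thesis .
qed

section \<open>Lower and upper bounds for the linear form\<close>

definition E :: "nat \<Rightarrow> real" where "E n = 2 * Im (A n * \<kappa>)"

text \<open>
  \<open>2 (Im z)\<^sup>2 = \<bar>z\<bar>\<^sup>2 - Re (z\<^sup>2)\<close> for \<open>z = A n * \<kappa>\<close>, and only \<open>\<kappa>\<^sup>2\<close> and \<open>\<bar>\<kappa>\<bar>\<^sup>2\<close> occur on the right: \<open>\<kappa>\<close> itself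
  need not lie in the quadratic field.
\<close>
lemma E_sq_integral: "(E n) ^ 2 \<in> \<int>"
proof -
  have "2 * (Im z) ^ 2 = (norm z) ^ 2 - Re (z ^ 2)" for z
    unfolding cmod_power2 by (simp add: power2_eq_square)
  from this[of "A n * \<kappa>"] have "(E n) ^ 2 = 2 * ((norm (A n * \<kappa>)) ^ 2 - Re ((A n * \<kappa>) ^ 2))"
    unfolding E_def by (simp only: power_mult_distrib) (simp del: times_complex.sel)
  also have "\<dots> = 2 * ((norm (A n)) ^ 2 * (norm \<kappa>) ^ 2 - Re (A n ^ 2 * \<kappa> ^ 2))"
    by (simp only: norm_mult power_mult_distrib)
  also have "(norm \<kappa>) ^ 2 = of_int (Y1 * Y2)"
    using M_pos by (simp add: \<kappa>_def norm_mult M_def)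
  finally have *: "(E n) ^ 2 = 2 * ((norm (A n)) ^ 2 * of_int (Y1 * Y2) - Re (A n ^ 2 * \<kappa> ^ 2))" .
  have "\<kappa> ^ 2 \<in> imag_order N" unfolding \<kappa>_sq imag_order_def s_def by blast
  moreover have "A n ^ 2 \<in> imag_order N" using N by (intro imag_order_power A_lattice) auto
  ultimately have "Re (A n ^ 2 * \<kappa> ^ 2) \<in> \<int>"
    using N by (intro imag_order_Re[of _ N] imag_order_mult) auto
  moreover have "(norm (A n)) ^ 2 \<in> \<int>" using N A_lattice by (intro imag_order_norm_sq) auto
  ultimately show ?thesis unfolding * by (intro Ints_mult Ints_diff) auto
qed

lemma E_ge_1: "E n \<noteq> 0 \<Longrightarrow> \<bar>E n\<bar> \<ge> 1"
proof -
  assume "E n \<noteq> 0"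
  obtain z :: int where z: "(E n) ^ 2 = of_int z" using E_sq_integral[of n] by (auto elim: Ints_cases)
  have "(E n) ^ 2 > 0" using \<open>E n \<noteq> 0\<close> by simp
  hence "z \<ge> 1" unfolding z by simp
  hence "1 \<le> (E n) ^ 2" unfolding z by simp
  thus ?thesis by (metis abs_le_square_iff abs_one one_power2)
qed

text \<open>\<open>A n * \<kappa>\<close> is a multiple of
  \<open>pade_sum n \<theta>1 * cis (\<theta>1 / 4)\<close>, whose imaginary part is the small sine
  polynomial, turned by \<open>- \<theta>2 / 4\<close>. The base \<open>32\<close> combines the
  \<open>8\<close> for the denominators with the \<open>4\<close> from the coefficient sum.\<close>

lemma E_bound: "\<bar>E n\<bar> \<le> 2 * sqrt M * (32 * \<rho>1) ^ n * (exp (of_nat n + 1) * \<theta>1 ^ (2 * n + 1) + \<theta>2 / 4)"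
proof -
  define z where "z = pade_sum n \<theta>1 * cis (\<theta>1 / 4)"
  have "cis (\<theta>1 / 4 - \<theta>2 / 4) = cis (\<theta>1 / 4) * cis (- (\<theta>2 / 4))" by (simp add: cis_mult)
  hence "A n * \<kappa> = of_real ((8 * \<rho>1) ^ n * sqrt M) * (z * cis (- (\<theta>2 / 4)))"
    unfolding A_def \<kappa>_def z_def by (simp add: diff_divide_distrib mult_ac)
  hence "\<bar>E n\<bar> = 2 * ((8 * \<rho>1) ^ n * sqrt M) * \<bar>Im (z * cis (- (\<theta>2 / 4)))\<bar>"
    unfolding E_def using \<rho>1_pos M_pos by (simp add: abs_mult power_mult_distrib)
  also have "\<bar>Im (z * cis (- (\<theta>2 / 4)))\<bar> \<le> \<bar>Im z\<bar> + 4 ^ n * \<bar>\<theta>2 / 4\<bar>"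
    by (rule Im_mult_cis_le) (simp add: z_def norm_mult norm_pade_sum_le)
  also have "\<bar>Im z\<bar> \<le> 4 ^ n * exp (of_nat n + 1) * \<bar>\<theta>1\<bar> ^ (2 * n + 1)"
    unfolding z_def Im_pade_sum_cis using \<theta>1_bounds by (intro pade_sin_bound) auto
  finally have "\<bar>E n\<bar> \<le> 2 * ((8 * \<rho>1) ^ n * sqrt M) * (4 ^ n * exp (of_nat n + 1) * \<bar>\<theta>1\<bar> ^ (2 * n + 1) + 4 ^ n * \<bar>\<theta>2 / 4\<bar>)"
    using \<rho>1_pos M_pos by (simp add: mult_left_mono)
  also have "\<dots> = 2 * sqrt M * ((8 * \<rho>1) ^ n * 4 ^ n) * (exp (of_nat n + 1) * \<theta>1 ^ (2 * n + 1) + \<theta>2 / 4)"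
    using \<theta>1_bounds \<theta>2_bounds by (simp add: algebra_simps)
  also have "(8 * \<rho>1) ^ n * 4 ^ n = (32 * \<rho>1) ^ n"
    unfolding power_mult_distrib[symmetric] by (rule arg_cong[of _ _ "\<lambda>x. x ^ n"]) simp
  finally show ?thesis .
qed

text \<open>If \<open>A n * \<kappa>\<close> and \<open>A (Suc n) * \<kappa>\<close> were both real,
  so would be \<open>pade_sum n \<theta>1 * cnj (pade_sum (Suc n) \<theta>1)\<close>, because
  \<kappa> enters only through \<open>\<kappa> * cnj \<kappa> = M\<close>.\<close>

lemma E_consecutive: "E n \<noteq> 0 \<or> E (Suc n) \<noteq> 0"
proof (rule ccontr)
  assume "\<not> ?thesis"
  hence 0: "Im (A n * \<kappa>) = 0" "Im (A (Suc n) * \<kappa>) = 0" by (auto simp: E_def)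
  have Im0: "Im (z * cnj w) = 0" if "Im z = 0" "Im w = 0" for z w
    using that by simp
  define c where "c = (8 * \<rho>1) ^ n * (8 * \<rho>1) ^ Suc n * M"
  have "Im (A n * \<kappa> * cnj (A (Suc n) * \<kappa>)) = 0"
    using Im0[OF 0] .
  moreover have "A n * \<kappa> * cnj (A (Suc n) * \<kappa>) = of_real c * (pade_sum n \<theta>1 * cnj (pade_sum (Suc n) \<theta>1))"
  proof -
    have "\<kappa> * cnj \<kappa> = of_real M" using M_pos
      by (simp add: \<kappa>_def cis_cnj cis_mult mult_ac flip: of_real_mult)
    have "A n * \<kappa> * cnj (A (Suc n) * \<kappa>) = A n * cnj (A (Suc n)) * (\<kappa> * cnj \<kappa>)" by (simp add: mult_ac)
    also have "\<dots> = of_real c * (pade_sum n \<theta>1 * cnj (pade_sum (Suc n) \<theta>1))"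
      unfolding \<open>\<kappa> * cnj \<kappa> = of_real M\<close> A_def c_def by (simp add: mult_ac)
    finally show ?thesis .
  qed
  moreover have "c > 0" unfolding c_def using \<rho>1_pos M_pos by simp
  moreover have "Im (of_real r * z) = r * Im z" for r z by simp
  ultimately have "Im (pade_sum n \<theta>1 * cnj (pade_sum (Suc n) \<theta>1)) = 0"
    by (metis less_irrefl mult_eq_0_iff)
  moreover have "\<theta>1 < pi" using \<theta>1_bounds pi_gt3 by simp
  ultimately show False using Im_pade_sum_mult_cnj_nonzero[of \<theta>1 n] \<theta>1_bounds by simp
qed

text \<open>This is the case \<open>n = 0\<close>: \<open>E 0\<close> is positive, hence at least
  \<open>1\<close>, and at most \<open>sqrt M * s / \<rho>1\<close>. The fourth power and
  \<open>M ^ 2 \<le> \<rho>1 * \<rho>2\<close> give the claim.\<close>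

lemma gap: "\<rho>1 ^ 3 \<le> \<rho>2 * (of_int N) ^ 2"
proof -
  have "pade_sum 0 \<theta>1 = 1" by (simp add: pade_sum_def pade_coeff_def)
  hence E0: "E 0 = 2 * sqrt M * sin ((\<theta>1 - \<theta>2) / 4)"
    by (simp add: E_def A_def \<kappa>_def)
  have pos: "sin ((\<theta>1 - \<theta>2) / 4) > 0"
    using \<theta>_less \<theta>1_bounds \<theta>2_bounds pi_gt3 by (intro sin_gt_zero) auto
  have "1 \<le> E 0" using E_ge_1[of 0] pos M_pos unfolding E0 by simp
  also have "sin ((\<theta>1 - \<theta>2) / 4) \<le> (2 * s / \<rho>1) / 4"
  proof -
    have "sin ((\<theta>1 - \<theta>2) / 4) \<le> (\<theta>1 - \<theta>2) / 4" using \<theta>_less by (intro sin_x_le_x) auto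
    moreover have "\<theta>1 / 4 \<le> (2 * s / \<rho>1) / 4" using \<theta>1_bounds(3) by (rule divide_right_mono) simp
    ultimately show ?thesis using \<theta>2_bounds(1) by (simp only: diff_divide_distrib)
  qed
  hence "E 0 \<le> 2 * sqrt M * ((2 * s / \<rho>1) / 4)" unfolding E0 using M_pos by (intro mult_left_mono) auto
  also have "2 * sqrt M * ((2 * s / \<rho>1) / 4) = sqrt M * s / \<rho>1" by simp
  finally have "\<rho>1 \<le> sqrt M * s" using \<rho>1_pos by (simp add: le_divide_eq)
  hence "\<rho>1 ^ 4 \<le> (sqrt M * s) ^ 4" using \<rho>1_pos by (intro power_mono) auto
  also have "\<dots> = M ^ 2 * (of_int N) ^ 2"
  proof -
    have "(sqrt M * s) ^ 4 = ((sqrt M) ^ 2 * s ^ 2) ^ 2" by (simp add: power_mult_distrib flip: power_mult)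
    thus ?thesis using M_pos s_sq by (simp add: power_mult_distrib)
  qed
  also have "\<dots> \<le> \<rho>1 * \<rho>2 * (of_int N) ^ 2"
    unfolding \<rho>_prod using D mult_right_mono[of 1 "real_of_int D" "M ^ 2"] by (intro mult_right_mono) auto
  finally have "\<rho>1 * \<rho>1 ^ 3 \<le> \<rho>1 * (\<rho>2 * (of_int N) ^ 2)" by (simp add: power4_eq_xxxx power3_eq_cube mult_ac)
  thus ?thesis using \<rho>1_pos by simp
qed

text \<open>Otherwise some \<open>m\<close> makes both \<open>E m\<close> and
  \<open>E (Suc m)\<close> smaller than \<open>1\<close> in absolute value, hence zero, against
  \<open>E_consecutive\<close>.\<close>

lemma far:
  assumes N_sq: "(of_int N) ^ 2 \<le> \<rho>1" and big: "2 ^ 96 \<le> \<rho>1"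
  shows "\<rho>2 < \<rho>1 ^ 64"
proof (rule ccontr)
  assume "\<not> ?thesis"
  hence far: "\<rho>1 ^ 64 \<le> \<rho>2" by simp
  \<comment> \<open>These roots keep all exponents integral: \<open>s \<le> l ^ 4\<close> and
    \<open>sqrt M \<le> l ^ 4 * g\<close>.\<close>
  define l where "l = root 16 \<rho>1"
  define g where "g = root 4 \<rho>2"
  have l: "\<rho>1 = l ^ 16" and g: "\<rho>2 = g ^ 4" using \<rho>1_pos \<rho>2_pos by (simp_all add: l_def g_def)
  have g0: "g > 0" using \<rho>2_pos by (simp add: g_def)
  have l0: "l > 0" using \<rho>1_pos by (simp add: l_def)
  have l64: "l \<ge> 64"
  proof -
    have "(64::real) ^ 16 \<le> l ^ 16" using big unfolding l by simp
    thus ?thesis using l0 by (subst (asm) power_mono_iff) auto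
  qed
  have g256: "l ^ 256 \<le> g"
  proof -
    have "(l ^ 256) ^ 4 \<le> g ^ 4" using far unfolding l g by (simp flip: power_mult)
    thus ?thesis using l0 g0 by (subst (asm) power_mono_iff) auto
  qed
  have sqrtM: "sqrt M \<le> l ^ 4 * g"
  proof -
    have "M ^ 2 \<le> of_int D * M ^ 2" using D mult_right_mono[of 1 "real_of_int D" "M ^ 2"] by auto
    also have "\<dots> = ((l ^ 4 * g) ^ 2) ^ 2"
      unfolding \<rho>_prod[symmetric] l g by (simp add: power_mult_distrib flip: power_mult)
    finally have "M \<le> (l ^ 4 * g) ^ 2" by (rule power2_le_imp_le) auto
    thus ?thesis using l0 g0 by (intro real_le_lsqrt) auto
  qed
  have s4: "s \<le> l ^ 4"
  proof -
    have "(of_int N) ^ 2 \<le> (l ^ 8) ^ 2" using N_sq unfolding l by (simp flip: power_mult)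
    hence "of_int N \<le> l ^ 8" by (rule power2_le_imp_le) (use l0 in auto)
    hence "s ^ 2 \<le> (l ^ 4) ^ 2" unfolding s_sq by (simp flip: power_mult)
    thus ?thesis by (rule power2_le_imp_le) (use l0 in auto)
  qed
  define q where "q = l ^ 6"
  have q1: "q > 1" unfolding q_def using l64 by (intro one_less_power) auto
  \<comment> \<open>\<open>m\<close> is chosen such that \<open>\<rho>1 powr (3 * m / 2)\<close> is just below \<open>\<rho>2\<close>, which makes both terms of \<open>E_bound\<close> small.\<close>
  define n where "n = (LEAST n. g < q ^ n)"
  have n: "g < q ^ n" unfolding n_def using real_arch_pow[OF q1, of g] by (rule LeastI_ex)
  \<comment> \<open>The exponent \<open>64\<close> enters here, as \<open>l ^ 256 \<le> g\<close>.
    Later \<open>m \<ge> 24\<close> absorbs a factor \<open>l ^ 24\<close> into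
    \<open>l ^ m\<close>.\<close>
  have n25: "n > 24"
  proof (rule ccontr)
    assume "\<not> n > 24"
    hence "q ^ n \<le> q ^ 24" using q1 by (intro power_increasing) auto
    also have "\<dots> = l ^ 144" by (simp add: q_def flip: power_mult)
    also have "\<dots> \<le> l ^ 256" using l64 by (intro power_increasing) auto
    finally show False using n g256 by linarith
  qed
  define m where "m = n - 1"
  have nm: "n = Suc m" using n25 by (simp add: m_def)
  have m24: "m \<ge> 24" using n25 nm by simp
  have "\<not> g < q ^ m" unfolding n_def
    by (rule not_less_Least) (use nm in \<open>simp add: n_def[symmetric]\<close>)
  hence gm: "q ^ m \<le> g" by simp
  have gm': "g < q ^ m * l ^ 6" using n unfolding nm by (simp add: q_def mult.commute)
  have E0: "E k = 0" if k: "m \<le> k" "k \<le> Suc m" for k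
  proof (rule ccontr)
    assume "E k \<noteq> 0"
    have t1: "\<theta>1 \<le> 2 / l ^ 12"
    proof -
      have "\<theta>1 \<le> 2 * s / \<rho>1" by (rule \<theta>1_bounds(3))
      also have "\<dots> \<le> 2 * l ^ 4 / l ^ 16" unfolding l using s4 l0 by (intro divide_right_mono) auto
      also have "\<dots> = 2 / l ^ 12" using l0 by (simp add: field_simps flip: power_add)
      finally show ?thesis .
    qed
    have t2: "\<theta>2 \<le> 2 * l ^ 4 / g ^ 4"
    proof -
      have "\<theta>2 \<le> 2 * s / \<rho>2" by (rule \<theta>2_bounds(3))
      also have "\<dots> \<le> 2 * l ^ 4 / g ^ 4" unfolding g using s4 g0 by (intro divide_right_mono) auto
      finally show ?thesis .
    qed
    have e3: "exp (of_nat k + 1) \<le> (3::real) ^ Suc k"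
    proof -
      have "exp (of_nat k + 1) = (exp 1 :: real) ^ Suc k"
        by (subst exp_of_nat_mult[symmetric]) (simp add: add.commute)
      also have "\<dots> \<le> 3 ^ Suc k" using exp_le by (intro power_mono) auto
      finally show ?thesis .
    qed
    have "\<bar>E k\<bar> \<le> 2 * sqrt M * (32 * \<rho>1) ^ k * (exp (of_nat k + 1) * \<theta>1 ^ (2 * k + 1) + \<theta>2 / 4)"
      by (rule E_bound)
    also have "\<dots> \<le> 2 * (l ^ 4 * g) * (32 * l ^ 16) ^ k * (3 ^ Suc k * (2 / l ^ 12) ^ (2 * k + 1) + (2 * l ^ 4 / g ^ 4) / 4)"
      unfolding l using l0 g0 \<theta>1_bounds \<theta>2_bounds M_pos
      by (intro mult_mono add_mono power_mono divide_right_mono sqrtM t1 t2 e3 order.refl add_nonneg_nonneg mult_nonneg_nonneg zero_le_power)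
         (auto intro: order.trans)
    also have "\<dots> = 2 * (l ^ 4 * g) * (32 * l ^ 16) ^ k * (3 ^ Suc k * (2 / l ^ 12) ^ (2 * k + 1))
                 + 2 * (l ^ 4 * g) * (32 * l ^ 16) ^ k * ((2 * l ^ 4 / g ^ 4) / 4)"
      by (simp only: distrib_left)
    finally have S: "\<bar>E k\<bar> \<le> 2 * (l ^ 4 * g) * (32 * l ^ 16) ^ k * (3 ^ Suc k * (2 / l ^ 12) ^ (2 * k + 1))
                 + 2 * (l ^ 4 * g) * (32 * l ^ 16) ^ k * ((2 * l ^ 4 / g ^ 4) / 4)" .
    \<comment> \<open>The first term does not increase with \<open>k\<close>, so
      \<open>k = m\<close> is the worst case, and it takes the upper bound \<open>gm'\<close> for
      \<open>g\<close>. The second term grows with \<open>k\<close>, so \<open>Suc m\<close> is the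
      worst case, and it takes the lower bound \<open>gm\<close>.\<close>
    have "2 * (l ^ 4 * g) * (32 * l ^ 16) ^ k * (3 ^ Suc k * (2 / l ^ 12) ^ (2 * k + 1))
       = 12 * g / l ^ 8 * ((32 * l ^ 16) * 3 * (2 / l ^ 12) ^ 2) ^ k"
proof -
  have 1: "(2 / l ^ 12) ^ (2 * k + 1) = (2 / l ^ 12) * ((2 / l ^ 12) ^ 2) ^ k"
    by (simp flip: power_mult)
  have 2: "2 * (l ^ 4 * g) * 3 * (2 / l ^ 12) = 12 * g / l ^ 8" using l0 by (simp add: field_simps flip: power_add)
  show ?thesis unfolding 1 2[symmetric] power_Suc power_mult_distrib by (simp only: mult_ac)
qed
    also have "(32 * l ^ 16) * 3 * (2 / l ^ 12) ^ 2 = 384 / l ^ 8"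
 using l0 by (simp add: power_divide field_simps flip: power_add power_mult)
    also have "12 * g / l ^ 8 * (384 / l ^ 8) ^ k \<le> 12 * (q ^ m * l ^ 6) / l ^ 8 * (384 / l ^ 8) ^ m"
    proof (intro mult_mono divide_right_mono)
      have "(64::real) ^ 8 \<le> l ^ 8" using l64 by (intro power_mono) auto
      hence "384 / l ^ 8 \<le> 1" using l0 by simp
      thus "(384 / l ^ 8) ^ k \<le> (384 / l ^ 8) ^ m" using k l0 by (intro power_decreasing) auto
    qed (use gm' l0 g0 q1 in auto)
    also have "\<dots> = 12 / l ^ 2 * (384 / l ^ 2) ^ m"
    proof -
      have 1: "q * (384 / l ^ 8) = 384 / l ^ 2" "12 * l ^ 6 / l ^ 8 = 12 / l ^ 2" 
        unfolding q_def using l0 by (simp_all add: field_simps flip: power_add)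
      have "12 * (q ^ m * l ^ 6) / l ^ 8 * (384 / l ^ 8) ^ m = (12 * l ^ 6 / l ^ 8) * (q * (384 / l ^ 8)) ^ m"
        unfolding power_mult_distrib by (simp only: mult_ac times_divide_eq_right times_divide_eq_left)
      thus ?thesis unfolding 1 .
    qed
    also have "\<dots> \<le> 12 / 64 ^ 2 * 1"
    proof (intro mult_mono)
      have "(64::real) ^ 2 \<le> l ^ 2" using l64 by (intro power_mono) auto
      thus "12 / l ^ 2 \<le> 12 / 64 ^ 2" using l0 by (intro divide_left_mono) auto
      show "(384 / l ^ 2) ^ m \<le> 1" using \<open>64 ^ 2 \<le> l ^ 2\<close> l0 by (intro power_le_one) auto
    qed (use l0 in auto)
    finally have S1: "2 * (l ^ 4 * g) * (32 * l ^ 16) ^ k * (3 ^ Suc k * (2 / l ^ 12) ^ (2 * k + 1)) \<le> 12 / 64 ^ 2"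
      by simp
    have "2 * (l ^ 4 * g) * (32 * l ^ 16) ^ k * ((2 * l ^ 4 / g ^ 4) / 4) = l ^ 8 * (32 * l ^ 16) ^ k / g ^ 3"
  proof -
    have 1: "2 * (l ^ 4 * g) * ((2 * l ^ 4 / g ^ 4) / 4) = l ^ 8 / g ^ 3"
      using g0 by (simp add: field_simps eval_nat_numeral)
    have "2 * (l ^ 4 * g) * (32 * l ^ 16) ^ k * ((2 * l ^ 4 / g ^ 4) / 4) = (2 * (l ^ 4 * g) * ((2 * l ^ 4 / g ^ 4) / 4)) * (32 * l ^ 16) ^ k"
      by (simp only: mult_ac)
    thus ?thesis unfolding 1 by simp
  qed
    also have "\<dots> \<le> l ^ 8 * (32 * l ^ 16) ^ Suc m / (q ^ m) ^ 3"
    proof (intro frac_le mult_left_mono power_mono power_increasing)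
      have "(64::real) ^ 16 \<le> l ^ 16" using l64 by (intro power_mono) auto
      thus "1 \<le> 32 * l ^ 16" by simp
    qed (use gm q1 k l0 in auto)
    also have "\<dots> = 32 * l ^ 24 * (32 / l ^ 2) ^ m"
    proof -
      have 1: "(q ^ m) ^ 3 = (q ^ 3) ^ m" by (simp add: mult.commute flip: power_mult)
      have 2: "32 * l ^ 16 / q ^ 3 = 32 / l ^ 2" "l ^ 8 * (32 * l ^ 16) = 32 * l ^ 24" unfolding q_def using l0 by (simp_all add: field_simps flip: power_add power_mult)
      have "l ^ 8 * (32 * l ^ 16) ^ Suc m / (q ^ m) ^ 3 = (l ^ 8 * (32 * l ^ 16)) * (32 * l ^ 16 / q ^ 3) ^ m"
        unfolding 1 power_divide by (simp only: power_Suc mult_ac times_divide_eq_right times_divide_eq_left)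
      thus ?thesis unfolding 2 .
    qed
    also have "\<dots> \<le> 32 * l ^ m * (32 / l ^ 2) ^ m"
      using m24 l64 by (intro mult_right_mono mult_left_mono power_increasing) auto
    also have "\<dots> = 32 * (32 / l) ^ m"
  proof -
    have "l * (32 / l ^ 2) = 32 / l" using l0 by (simp add: field_simps power2_eq_square)
    thus ?thesis using power_mult_distrib[of l "32 / l ^ 2" m] by (simp add: mult_ac)
  qed
    also have "\<dots> \<le> 32 * (1 / 2) ^ m"
      using l64 by (intro mult_left_mono power_mono) auto
    also have "\<dots> \<le> 32 * (1 / 2) ^ 24"
      using m24 by (intro mult_left_mono power_decreasing) auto
    finally have S2: "2 * (l ^ 4 * g) * (32 * l ^ 16) ^ k * ((2 * l ^ 4 / g ^ 4) / 4) \<le> 32 * (1 / 2) ^ 24" .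
    have "\<bar>E k\<bar> \<le> 12 / 64 ^ 2 + 32 * (1 / 2) ^ 24" using S S1 S2 by linarith
    also have "\<dots> < 1" by (simp add: power_divide)
    finally show False using E_ge_1[OF \<open>E k \<noteq> 0\<close>] by linarith
  qed
  show False using E0[of m] E0[of "Suc m"] E_consecutive[of m] by simp
qed

end

section \<open>Units\<close>

text \<open>A nonzero \<open>q\<close> would divide \<open>p\<close>, and \<open>D\<close> would be
  the square of the quotient. This serves the uniqueness of coordinates and the nonvanishing of
  norms.\<close>

lemma squarefree_not_square:
  fixes D p q :: int
  assumes "D > 1" "squarefree D" "p ^ 2 = D * q ^ 2"
  shows "q = 0"
proof (rule ccontr)
  assume q: "q \<noteq> 0"
  have "q ^ 2 dvd p ^ 2" using assms(3) by simp
  hence "q dvd p" by simp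
  then obtain e where e: "p = q * e" by (elim dvdE)
  hence "e ^ 2 = D" using assms(3) q by (simp add: power_mult_distrib)
  hence "e ^ 2 dvd D" by simp
  with assms(2) have "e dvd 1" by (rule squarefreeD)
  hence "\<bar>e\<bar> = 1" by simp
  hence "e ^ 2 = 1" by (metis one_power2 power2_abs)
  thus False using \<open>e ^ 2 = D\<close> assms(1) by simp
qed

locale squarefree_int =
  fixes D :: int
  assumes D1: "D > 1" and sqf: "squarefree D"
begin

lemma sqrt_D_sq: "sqrt (of_int D) * sqrt (of_int D) = of_int D"
  using D1 by simp

lemma sqrt_D_gt_1: "sqrt (of_int D) > 1"
  using D1 by simp

lemma Zsqrt_eq_iff:
  "of_int a + of_int b * sqrt (of_int D) = of_int c + of_int d * sqrt (of_int D) \<longleftrightarrow> a = c \<and> b = d"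
proof
  assume eq: "of_int a + of_int b * sqrt (of_int D) = of_int c + of_int d * sqrt (of_int D)"
  hence "of_int (a - c) = of_int (d - b) * sqrt (of_int D)" by (simp add: algebra_simps)
  hence "(of_int (a - c)) ^ 2 = (of_int (d - b) * sqrt (of_int D)) ^ 2" by (rule arg_cong)
  hence "real_of_int ((a - c) ^ 2) = of_int (D * (d - b) ^ 2)"
    using D1 by (simp add: power_mult_distrib mult.commute)
  hence "(a - c) ^ 2 = D * (d - b) ^ 2" by (simp only: of_int_eq_iff)
  hence "d - b = 0" by (rule squarefree_not_square[OF D1 sqf])
  thus "a = c \<and> b = d" using eq by simp
qed auto

lemma sqrt_D_irrational: "sqrt (of_int D) \<notin> \<rat>"
proof
  assume "sqrt (of_int D) \<in> \<rat>"
  then obtain p q :: int where pq: "sqrt (of_int D) = of_int p / of_int q" "q > 0"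
    by (meson Rats_cases')
  hence "of_int q * sqrt (of_int D) = of_int p" by simp
  hence "of_int p + of_int 0 * sqrt (of_int D) = of_int 0 + of_int q * sqrt (of_int D)" by simp
  hence "q = 0" unfolding Zsqrt_eq_iff by simp
  thus False using pq by simp
qed

lemma Zsqrt_mult_eq:
  "(of_int a + of_int b * sqrt (of_int D)) * (of_int c + of_int d * sqrt (of_int D))
     = of_int (a * c + D * b * d) + of_int (a * d + b * c) * sqrt (of_int D)"
proof -
  have "(of_int a + of_int b * sqrt (of_int D)) * (of_int c + of_int d * sqrt (of_int D))
     = of_int (a * c) + of_int (b * d) * (sqrt (of_int D) * sqrt (of_int D)) + of_int (a * d + b * c) * sqrt (of_int D)"
    by (simp add: algebra_simps)
  thus ?thesis unfolding sqrt_D_sq by (simp add: mult_ac)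
qed

text \<open>Good rational approximations give infinitely many \<open>h + k \<surd>D\<close> of
  bounded norm. Two of them agree in the norm \<open>n\<close> and in both coordinates modulo
  \<open>n\<close>; up to conjugation and sign their quotient is the unit.\<close>

lemma pell_solvable: "\<exists>a b :: int. a > 0 \<and> b > 0 \<and> a ^ 2 - D * b ^ 2 = 1"
proof -
  define \<theta> where "\<theta> = sqrt (of_int D)"
  define f where "f = (\<lambda>(h, k). let n = h ^ 2 - D * k ^ 2 in (n, h mod n, k mod n))"
  define B where "B = \<lceil>1 + 2 * \<theta>\<rceil>"
  have \<theta>: "\<theta> > 1" using sqrt_D_gt_1 by (simp add: \<theta>_def)
  have inf: "infinite (approx_set \<theta>)"
    using rational_iff_finite_approx_set[of \<theta>] sqrt_D_irrational by (simp add: \<theta>_def)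
  have n_le: "\<bar>h ^ 2 - D * k ^ 2\<bar> \<le> B" and n0: "h ^ 2 - D * k ^ 2 \<noteq> 0" and k0: "k > 0" and cop: "coprime h k"
    if "(h, k) \<in> approx_set \<theta>" for h k
  proof -
    from that have *: "k > 0" "coprime h k" "\<bar>\<theta> - of_int h / of_int k\<bar> < 1 / (of_int k)\<^sup>2"
      unfolding approx_set_def by auto
    define K where "K = real_of_int k"
    have K: "K \<ge> 1" using *(1) by (simp add: K_def)
    have "\<bar>of_int h - K * \<theta>\<bar> = K * \<bar>\<theta> - of_int h / K\<bar>"
    proof -
      have "of_int h - K * \<theta> = - (K * (\<theta> - of_int h / K))" using K by (simp add: field_simps)
      thus ?thesis using K by (simp only: abs_minus_cancel abs_mult abs_of_pos)
    qed
    also have "\<dots> \<le> K * (1 / K ^ 2)" using *(3) K by (intro mult_left_mono) (auto simp: K_def)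
    also have "\<dots> = 1 / K" using K by (simp add: power2_eq_square)
    finally have d: "\<bar>of_int h - K * \<theta>\<bar> \<le> 1 / K" .
    have "1 / K \<le> 1" using K by simp
    have "K * \<theta> > 0" using K \<theta> by simp
    hence "\<bar>of_int h + K * \<theta>\<bar> \<le> \<bar>of_int h - K * \<theta>\<bar> + 2 * (K * \<theta>)" by linarith
    also have "\<dots> \<le> 1 * K + 2 * (K * \<theta>)" using d \<open>1 / K \<le> 1\<close> K by linarith
    also have "\<dots> = K * (1 + 2 * \<theta>)" by (simp add: algebra_simps)
    finally have s: "\<bar>of_int h + K * \<theta>\<bar> \<le> K * (1 + 2 * \<theta>)" .
    have "real_of_int (h ^ 2 - D * k ^ 2) = (of_int h - K * \<theta>) * (of_int h + K * \<theta>)"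
      using D1 by (simp add: K_def \<theta>_def algebra_simps power2_eq_square)
    hence "\<bar>real_of_int (h ^ 2 - D * k ^ 2)\<bar> \<le> 1 / K * (K * (1 + 2 * \<theta>))"
      unfolding abs_mult using d s K by (simp only: abs_mult) (intro mult_mono, auto)
    also have "\<dots> \<le> of_int B" using K by (simp add: B_def)
    finally show "\<bar>h ^ 2 - D * k ^ 2\<bar> \<le> B" by linarith
    show "h ^ 2 - D * k ^ 2 \<noteq> 0" using squarefree_not_square[OF D1 sqf, of h k] *(1) by auto
    show "k > 0" "coprime h k" by fact+
  qed
  have "f ` approx_set \<theta> \<subseteq> {-B..B} \<times> {-B..B} \<times> {-B..B}"
  proof
    fix z assume "z \<in> f ` approx_set \<theta>"
    then obtain h k where hk: "(h, k) \<in> approx_set \<theta>" "z = f (h, k)" by auto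
    define n where "n = h ^ 2 - D * k ^ 2"
    have n: "\<bar>n\<bar> \<le> B" "n \<noteq> 0" using n_le n0 hk(1) by (auto simp: n_def)
    have "\<bar>x mod n\<bar> \<le> B" for x using n abs_mod_less[of n x] by linarith
    moreover have "z = (n, h mod n, k mod n)" using hk(2) by (simp add: f_def n_def Let_def)
    ultimately show "z \<in> {-B..B} \<times> {-B..B} \<times> {-B..B}" using n(1) by (auto simp: abs_le_iff minus_le_iff)
  qed
  hence "finite (f ` approx_set \<theta>)" by (rule finite_subset) auto
  then obtain z where z: "z \<in> approx_set \<theta>" "infinite {x \<in> approx_set \<theta>. f x = f z}"
    using pigeonhole_infinite[OF inf] by blast
  obtain z' where z': "z' \<in> {x \<in> approx_set \<theta>. f x = f z} - {z}"
    using z(2) infinite_imp_nonempty[OF infinite_remove[OF z(2), of z]] by blast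
  obtain h k h' k' where hk: "z = (h, k)" "z' = (h', k')" by (cases z, cases z') auto
  define n where "n = h ^ 2 - D * k ^ 2"
  have mem: "(h, k) \<in> approx_set \<theta>" "(h', k') \<in> approx_set \<theta>" using z z' hk by auto
  have n': "h' ^ 2 - D * k' ^ 2 = n" and m: "h' mod n = h mod n" "k' mod n = k mod n"
    using z' hk by (auto simp: f_def n_def Let_def)
  have n0': "n \<noteq> 0" using n0[OF mem(1)] by (simp add: n_def)
  have c: "[h' = h] (mod n)" "[k' = k] (mod n)" using m by (auto simp: cong_def)
  \<comment> \<open>The integers divided by \<open>n\<close> here and below are the coordinates of
    \<open>(h + k \<surd>D) (h' - k' \<surd>D)\<close>.\<close>
  have "[h * h' - D * k * k' = h * h - D * k * k] (mod n)"
    by (intro cong_diff cong_mult cong_refl c)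
  hence "n dvd h * h' - D * k * k'"
    by (subst cong_dvd_iff) (auto simp: n_def power2_eq_square mult.assoc)
  then obtain a where a: "h * h' - D * k * k' = n * a" by (elim dvdE)
  have "[k * h' - h * k' = k * h - h * k] (mod n)"
    by (intro cong_diff cong_mult cong_refl c)
  hence "n dvd k * h' - h * k'" by (subst cong_dvd_iff) auto
  then obtain b where b: "k * h' - h * k' = n * b" by (elim dvdE)
  have "n ^ 2 * (a ^ 2 - D * b ^ 2) = (n * a) ^ 2 - D * (n * b) ^ 2" by (simp add: algebra_simps power_mult_distrib)
  also have "\<dots> = (h ^ 2 - D * k ^ 2) * (h' ^ 2 - D * k' ^ 2)"
    unfolding a[symmetric] b[symmetric] by (simp add: algebra_simps power2_eq_square)
  also have "\<dots> = n ^ 2" unfolding n' n_def[symmetric] by (simp add: power2_eq_square)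
  finally have ab: "a ^ 2 - D * b ^ 2 = 1" using n0' by simp
  \<comment> \<open>\<open>b = 0\<close> makes the two pairs proportional. Being coprime with
    positive second entry they would coincide, but \<open>z'\<close> differs from
    \<open>z\<close>.\<close>
  have "b \<noteq> 0"
  proof
    assume "b = 0"
    hence e: "k * h' = h * k'" using b by simp
    have kp: "k > 0" "k' > 0" and co: "coprime h k" "coprime h' k'" using k0 cop mem by auto
    have "k dvd k'" using e co(1) by (metis coprime_commute coprime_dvd_mult_right_iff dvd_triv_left)
    moreover have "k' dvd k" using e co(2) by (metis coprime_commute coprime_dvd_mult_left_iff dvd_triv_right)
    ultimately have "k = k'" using kp by (simp add: zdvd_antisym_nonneg)
    hence "h = h'" using e kp by simp
    thus False using \<open>k = k'\<close> z' hk by simp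
  qed
  moreover have "a \<noteq> 0"
  proof
    assume "a = 0"
    hence "D * b ^ 2 = -1" using ab by simp
    moreover have "D * b ^ 2 \<ge> 0" using D1 by simp
    ultimately show False by simp
  qed
  ultimately show ?thesis using ab by (intro exI[of _ "\<bar>a\<bar>"] exI[of _ "\<bar>b\<bar>"]) auto
qed

section \<open>The unit group and its least element above \<open>1\<close>\<close>

lemma Zsqrt_units_norm:
  assumes "x \<in> Zsqrt_units D"
  obtains a b where "x = of_int a + of_int b * sqrt (of_int D)" "\<bar>a ^ 2 - D * b ^ 2\<bar> = 1"
proof -
  from assms obtain a b c d where x: "x = of_int a + of_int b * sqrt (of_int D)"
    and eq: "x * (of_int c + of_int d * sqrt (of_int D)) = 1"
    unfolding Zsqrt_units_def Zsqrt_def by blast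
  have "of_int (a * c + D * b * d) + of_int (a * d + b * c) * sqrt (of_int D) = of_int 1 + of_int 0 * sqrt (of_int D)"
    using eq unfolding x Zsqrt_mult_eq by simp
  hence e: "a * c + D * b * d = 1" "a * d + b * c = 0" unfolding Zsqrt_eq_iff by auto
  have "(a ^ 2 - D * b ^ 2) * (c ^ 2 - D * d ^ 2) = (a * c + D * b * d) ^ 2 - D * (a * d + b * c) ^ 2"
    by (simp add: algebra_simps power2_eq_square)
  hence "(a ^ 2 - D * b ^ 2) * (c ^ 2 - D * d ^ 2) = 1" unfolding e by simp
  hence "\<bar>a ^ 2 - D * b ^ 2\<bar> = 1" by (rule zmult_eq_1_iff[THEN iffD1, THEN disjE]) auto
  thus ?thesis using x that by blast
qed

lemma Zsqrt_unitsI: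
  assumes "a ^ 2 - D * b ^ 2 = 1"
  shows "of_int a + of_int b * sqrt (of_int D) \<in> Zsqrt_units D"
proof -
  have "(of_int a + of_int b * sqrt (of_int D)) * (of_int a + of_int (- b) * sqrt (of_int D)) = 1"
    unfolding Zsqrt_mult_eq using arg_cong[OF assms, of real_of_int] by (simp add: power2_eq_square)
  thus ?thesis unfolding Zsqrt_units_def Zsqrt_def by blast
qed

lemma Zsqrt_units_mult:
  assumes "x \<in> Zsqrt_units D" "y \<in> Zsqrt_units D"
  shows "x * y \<in> Zsqrt_units D"
proof -
  have Z: "x * y \<in> Zsqrt D" if "x \<in> Zsqrt D" "y \<in> Zsqrt D" for x y
    using that Zsqrt_mult_eq unfolding Zsqrt_def by blast
  obtain x' y' where "x' \<in> Zsqrt D" "x * x' = 1" "y' \<in> Zsqrt D" "y * y' = 1"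
    using assms by (auto simp: Zsqrt_units_def)
  moreover from this have "(x * y) * (x' * y') = 1" by (metis mult.commute mult.left_commute mult_1)
  ultimately show ?thesis using assms Z by (auto simp: Zsqrt_units_def intro!: bexI[of _ "x' * y'"])
qed

lemma Zsqrt_units_1: "1 \<in> Zsqrt_units D"
  using Zsqrt_unitsI[of 1 0] by simp

lemma Zsqrt_units_inverse:
  assumes "x \<in> Zsqrt_units D"
  shows "inverse x \<in> Zsqrt_units D"
proof -
  obtain y where y: "y \<in> Zsqrt D" "x * y = 1" "x \<in> Zsqrt D"
    using assms by (auto simp: Zsqrt_units_def)
  hence "inverse x = y" by (metis inverse_unique)
  thus ?thesis using y by (auto simp: Zsqrt_units_def mult.commute)
qed

lemma Zsqrt_units_power: "x \<in> Zsqrt_units D \<Longrightarrow> x ^ n \<in> Zsqrt_units D"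
  by (induction n) (auto intro: Zsqrt_units_mult Zsqrt_units_1)

lemma Zsqrt_units_power_int: "x \<in> Zsqrt_units D \<Longrightarrow> x powi n \<in> Zsqrt_units D"
  by (auto simp: power_int_def intro: Zsqrt_units_power Zsqrt_units_inverse)

text \<open>The conjugate \<open>y\<close> satisfies \<open>\<bar>x * y\<bar> = 1\<close>, so
  \<open>\<bar>y\<bar> < 1 < x\<close>, and both \<open>x + y\<close> and \<open>x - y\<close> are
  positive.\<close>

lemma unit_coords_pos:
  assumes "x = of_int a + of_int b * sqrt (of_int D)" "\<bar>a ^ 2 - D * b ^ 2\<bar> = 1" "x > 1"
  shows "a > 0" "b > 0"
proof -
  define y where "y = of_int a - of_int b * sqrt (of_int D)"
  have "x * y = of_int (a ^ 2 - D * b ^ 2)"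
    using D1 unfolding assms(1) y_def by (simp add: algebra_simps power2_eq_square)
  hence "\<bar>x\<bar> * \<bar>y\<bar> = 1" unfolding abs_mult[symmetric] using assms(2) by (metis of_int_1 of_int_abs)
  hence y: "\<bar>y\<bar> < x" "\<bar>y\<bar> < 1" using assms(3)
    by (smt (verit) mult_less_cancel_left2 mult_le_cancel_right1)+
  have "2 * of_int a = x + y" "2 * (of_int b * sqrt (of_int D)) = x - y" by (auto simp: assms(1) y_def)
  hence "real_of_int a > 0" "of_int b * sqrt (of_int D) > 0" using y by linarith+
  thus "a > 0" "b > 0" using sqrt_D_gt_1 by (auto simp: zero_less_mult_iff)
qed

text \<open>The \<open>LEAST\<close> over the reals needs an actual minimum. A solution of the Pell
  equation gives a unit \<open>x0\<close>, and the units in \<open>(1, x0]\<close> have positive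
  coordinates bounded by \<open>x0\<close>, so they are finitely many.\<close>

lemma fund_unit_least:
  "fund_unit D \<in> Zsqrt_units D" "fund_unit D > 1"
  "\<And>x. x \<in> Zsqrt_units D \<Longrightarrow> x > 1 \<Longrightarrow> fund_unit D \<le> x"
proof -
  define P where "P = (\<lambda>x. x \<in> Zsqrt_units D \<and> x > 1)"
  obtain a b where ab: "a > 0" "b > 0" "a ^ 2 - D * b ^ 2 = 1" using pell_solvable by blast
  define x0 where "x0 = of_int a + of_int b * sqrt (of_int D)"
  have "real_of_int a \<ge> 1" "of_int b * sqrt (of_int D) > 0" using ab sqrt_D_gt_1 by auto
  hence Px0: "P x0" using Zsqrt_unitsI[OF ab(3)] by (simp add: P_def x0_def)
  define S where "S = {x. P x \<and> x \<le> x0}"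
  have "S \<subseteq> (\<lambda>(a, b). of_int a + of_int b * sqrt (of_int D)) ` ({0..\<lceil>x0\<rceil>} \<times> {0..\<lceil>x0\<rceil>})"
  proof
    fix x assume "x \<in> S"
    hence x: "x \<in> Zsqrt_units D" "x > 1" "x \<le> x0" by (auto simp: S_def P_def)
    obtain c d where cd: "x = of_int c + of_int d * sqrt (of_int D)" "\<bar>c ^ 2 - D * d ^ 2\<bar> = 1"
      using Zsqrt_units_norm[OF x(1)] by blast
    note pos = unit_coords_pos[OF cd x(2)]
    have "of_int d * 1 \<le> of_int d * sqrt (of_int D)" using pos sqrt_D_gt_1 by (intro mult_left_mono) auto
    moreover have "real_of_int c > 0" "real_of_int d > 0" using pos by auto
    ultimately have "of_int c \<le> x0" "of_int d \<le> x0" using cd(1) x(3) by linarith+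
    hence "c \<le> \<lceil>x0\<rceil>" "d \<le> \<lceil>x0\<rceil>" by linarith+
    thus "x \<in> (\<lambda>(a, b). of_int a + of_int b * sqrt (of_int D)) ` ({0..\<lceil>x0\<rceil>} \<times> {0..\<lceil>x0\<rceil>})"
      using cd(1) pos by auto
  qed
  hence fin: "finite S" by (rule finite_subset) auto
  have ne: "S \<noteq> {}" using Px0 by (auto simp: S_def)
  have PMin: "P (Min S)" using Min_in[OF fin ne] by (simp add: S_def)
  have le: "Min S \<le> x" if "P x" for x
  proof (cases "x \<le> x0")
    case True
    thus ?thesis using that fin by (intro Min_le) (auto simp: S_def)
  next
    case False
    have "Min S \<le> x0" using Min_in[OF fin ne] by (simp add: S_def)
    thus ?thesis using False by simp
  qed
  have "fund_unit D = Min S" unfolding fund_unit_def P_def[symmetric]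
    by (rule Least_equality) (use PMin le in auto)
  thus "fund_unit D \<in> Zsqrt_units D" "fund_unit D > 1"
    "\<And>x. x \<in> Zsqrt_units D \<Longrightarrow> x > 1 \<Longrightarrow> fund_unit D \<le> x"
    using PMin le by (auto simp: P_def)
qed

lemma fund_unit_ge: "fund_unit D \<ge> 1 + sqrt (of_int D)"
proof -
  obtain a b where ab: "fund_unit D = of_int a + of_int b * sqrt (of_int D)" "\<bar>a ^ 2 - D * b ^ 2\<bar> = 1"
    using Zsqrt_units_norm[OF fund_unit_least(1)] by blast
  note pos = unit_coords_pos[OF ab fund_unit_least(2)]
  have "1 * sqrt (of_int D) \<le> of_int b * sqrt (of_int D)" using pos sqrt_D_gt_1 by (intro mult_right_mono) auto
  moreover have "real_of_int a \<ge> 1" using pos by simp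
  ultimately show ?thesis unfolding ab(1) by linarith
qed

text \<open>Powers of \<open>e\<close> bring \<alpha> and \<beta> into \<open>[1, e)\<close>. The
  quotient \<open>w\<close> of the results is a unit strictly between \<open>1 / e\<close> and
  \<open>e\<close>, so it is \<open>1\<close> by minimality of \<open>e\<close>.\<close>

lemma unit_eq_power:
  assumes u: "u \<in> Zsqrt_units D" and \<alpha>: "\<alpha> > 0" "\<beta> > 0" "\<alpha> = u * \<beta>"
    and j: "\<lfloor>log (fund_unit D) \<alpha>\<rfloor> - \<lfloor>log (fund_unit D) \<beta>\<rfloor> = j"
  shows "u = fund_unit D powi j"
proof -
  define e where "e = fund_unit D"
  have e: "e > 1" using fund_unit_least(2) by (simp add: e_def)
  have pw: "e powi \<lfloor>log e x\<rfloor> \<le> x" "x < e powi \<lfloor>log e x\<rfloor> * e" if "x > 0" for x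
  proof -
    have "e powr of_int \<lfloor>log e x\<rfloor> \<le> e powr (log e x)" using e by (intro powr_mono) auto
    thus "e powi \<lfloor>log e x\<rfloor> \<le> x" using e that by (simp add: powr_real_of_int')
    have "e powr (log e x) < e powr (of_int \<lfloor>log e x\<rfloor> + 1)" using e real_of_int_floor_add_one_gt[of "log e x"] by (intro powr_less_mono) auto
    also have "\<dots> = e powi \<lfloor>log e x\<rfloor> * e" using e by (simp add: powr_add powr_real_of_int')
    finally show "x < e powi \<lfloor>log e x\<rfloor> * e" using e that by simp
  qed
  define w where "w = u * e powi (- j)"
  have wU: "w \<in> Zsqrt_units D" unfolding w_def e_def
    by (intro Zsqrt_units_mult u Zsqrt_units_power_int fund_unit_least(1))
  define ma mb where "ma = \<lfloor>log e \<alpha>\<rfloor>" and "mb = \<lfloor>log e \<beta>\<rfloor>"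
  have jm: "j = ma - mb" using j by (simp add: ma_def mb_def e_def)
  have w: "w * (\<beta> / e powi mb) = \<alpha> / e powi ma"
    using e \<alpha>(3) by (simp add: w_def jm power_int_diff power_int_minus field_simps)
  have fa: "1 \<le> \<alpha> / e powi ma" "\<alpha> / e powi ma < e"
    using pw[OF \<alpha>(1)] e by (auto simp: ma_def field_simps)
  have fb: "1 \<le> \<beta> / e powi mb" "\<beta> / e powi mb < e"
    using pw[OF \<alpha>(2)] e by (auto simp: mb_def field_simps)
  have w0: "w > 0"
    using w fa fb by (smt (verit) mult_nonneg_nonpos mult_nonneg_nonneg mult_nonpos_nonneg)
  have "\<not> w > 1"
  proof
    assume "w > 1"
    hence "e \<le> w" using fund_unit_least(3)[OF wU] by (simp add: e_def)
    also have "w * 1 \<le> w * (\<beta> / e powi mb)" using fb w0 by (intro mult_left_mono) auto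
    hence "w \<le> \<alpha> / e powi ma" using w by simp
    finally show False using fa by simp
  qed
  moreover have "\<not> w < 1"
  proof
    assume "w < 1"
    hence "inverse w > 1" using w0 by (simp add: one_less_inverse)
    hence "e \<le> inverse w" using fund_unit_least(3)[OF Zsqrt_units_inverse[OF wU]] by (simp add: e_def)
    hence "e * w \<le> 1" using w0 by (simp add: field_simps)
    moreover have "w * (\<beta> / e powi mb) < w * e" using fb w0 by (intro mult_strict_left_mono) auto
    ultimately show False using w fa by (simp add: mult.commute)
  qed
  ultimately have "w = 1" by simp
  thus ?thesis using e by (simp add: w_def e_def power_int_minus field_simps)
qed

text \<open>The fundamental unit may have norm \<open>-1\<close>; an even exponent forces norm
  \<open>1\<close>.\<close>

lemma fund_unit_even_power:
  assumes "j > 0"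
  obtains a b where "fund_unit D ^ (2 * j) = of_int a + of_int b * sqrt (of_int D)"
    "a > 0" "b > 0" "a ^ 2 - D * b ^ 2 = 1"
proof -
  define x where "x = fund_unit D ^ j"
  have "x \<in> Zsqrt_units D" unfolding x_def by (intro Zsqrt_units_power fund_unit_least)
  then obtain c d where cd: "x = of_int c + of_int d * sqrt (of_int D)" "\<bar>c ^ 2 - D * d ^ 2\<bar> = 1"
    using Zsqrt_units_norm by blast
  define a b where "a = c * c + D * d * d" and "b = c * d + d * c"
  have eq: "fund_unit D ^ (2 * j) = of_int a + of_int b * sqrt (of_int D)"
  proof -
    have "fund_unit D ^ (2 * j) = x * x" by (simp add: x_def power_add mult_2)
    thus ?thesis unfolding cd(1) Zsqrt_mult_eq a_def b_def .
  qed
  have "a ^ 2 - D * b ^ 2 = (c ^ 2 - D * d ^ 2) ^ 2"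
    by (simp add: a_def b_def algebra_simps power2_eq_square)
  also have "\<dots> = 1" using cd(2) by (metis one_power2 power2_abs)
  finally have n: "a ^ 2 - D * b ^ 2 = 1" .
  have "fund_unit D ^ (2 * j) > 1" using fund_unit_least(2) assms by (intro one_less_power) auto
  from unit_coords_pos[OF eq _ this] n show ?thesis using eq that by auto
qed

end

section \<open>Counting classes\<close>

text \<open>\<open>p ^ e\<close> divides \<open>(t - t0) * (t + t0)\<close>. An odd \<open>p\<close>
  cannot divide both factors, since it does not divide \<open>2 * t\<close>. For
  \<open>p = 2\<close> both factors are even and exactly one of their halves is odd; the
  \<open>2\<close> in the conclusion pays for this.\<close>

lemma prime_power_dvd_double_diff_or_sum:
  fixes p t t0 D :: int
  assumes p: "prime p" "\<not> p dvd D" and e: "e > 0"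
    and t: "p ^ e dvd t ^ 2 - D" and t0: "p ^ e dvd t0 ^ 2 - D"
  shows "p ^ e dvd 2 * (t - t0) \<or> p ^ e dvd 2 * (t + t0)"
proof -
  have prod: "p ^ e dvd (t - t0) * (t + t0)"
    using dvd_diff[OF t t0] by (simp add: algebra_simps power2_eq_square)
  have p_dvd: "p dvd p ^ e" using e by simp
  have nd: "\<not> p dvd x" if "p ^ e dvd x ^ 2 - D" for x
  proof
    assume "p dvd x"
    hence "p dvd x ^ 2" by (simp add: power2_eq_square)
    moreover have "p dvd x ^ 2 - D" using p_dvd that by (rule dvd_trans)
    ultimately have "p dvd x ^ 2 - (x ^ 2 - D)" by (rule dvd_diff)
    thus False using p by simp
  qed
  show ?thesis
  proof (cases "p = 2")
    case False
    have "\<not> p dvd t - t0 \<or> \<not> p dvd t + t0"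
    proof (rule ccontr)
      assume "\<not> ?thesis"
      hence "p dvd (t - t0) + (t + t0)" using dvd_add by blast
      hence "p dvd 2 * t" by simp
      hence "p dvd 2 \<or> p dvd t" using p(1) by (simp add: prime_dvd_mult_iff)
      moreover have "\<not> p dvd 2" using p(1) False by (metis primes_dvd_imp_eq two_is_prime_nat prime_int_numeral_eq prime_nat_numeral_eq)
      ultimately show False using nd[OF t] by simp
    qed
    thus ?thesis
    proof
      assume "\<not> p dvd t - t0"
      hence "coprime (p ^ e) (t - t0)" using p(1) by (simp add: prime_imp_coprime coprime_power_left_iff)
      hence "p ^ e dvd t + t0" using prod by (simp add: coprime_dvd_mult_right_iff)
      thus ?thesis using dvd_mult by blast
    next
      assume "\<not> p dvd t + t0"
      hence "coprime (p ^ e) (t + t0)" using p(1) by (simp add: prime_imp_coprime coprime_power_left_iff)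
      hence "p ^ e dvd t - t0" using prod by (simp add: coprime_dvd_mult_left_iff)
      thus ?thesis using dvd_mult by blast
    qed
  next
    case True
    have odd: "odd t" "odd t0" using nd[OF t] nd[OF t0] True by auto
    hence "2 dvd t - t0" by simp
    then obtain c where c: "t - t0 = 2 * c" by (elim dvdE)
    have d: "t + t0 = 2 * (t - c)" using c unfolding right_diff_distrib by simp
    show ?thesis
    proof (cases "odd c")
      case True
      hence "coprime (p ^ e) c" unfolding \<open>p = 2\<close> by (cases "e = 0") (auto simp: coprime_power_left_iff)
      moreover have "p ^ e dvd c * (2 * (t + t0))" using prod unfolding c by (simp only: mult.left_commute mult.commute mult.assoc)
      ultimately have "p ^ e dvd 2 * (t + t0)" by (simp add: coprime_dvd_mult_right_iff)
      thus ?thesis ..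
    next
      case False
      hence "odd (t - c)" using odd by simp
      hence "coprime (p ^ e) (t - c)" unfolding \<open>p = 2\<close> by (cases "e = 0") (auto simp: coprime_power_left_iff)
      moreover have "p ^ e dvd (t - c) * (2 * (t - t0))" using prod unfolding d by (simp only: mult.left_commute mult.commute)
      ultimately have "p ^ e dvd 2 * (t - t0)" by (simp add: coprime_dvd_mult_right_iff)
      thus ?thesis ..
    qed
  qed
qed

lemma dvd_if_prime_powers_dvd:
  fixes n x :: int
  assumes "n \<noteq> 0" "\<And>p. p \<in> prime_factors n \<Longrightarrow> p ^ multiplicity p n dvd x"
  shows "n dvd x"
proof (cases "x = 0")
  case False
  show ?thesis
  proof (rule multiplicity_le_imp_dvd[OF assms(1)])
    fix p :: int assume p: "prime p"
    show "multiplicity p n \<le> multiplicity p x"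
    proof (cases "p dvd n")
      case True
      hence "p ^ multiplicity p n dvd x" using p assms by (intro assms(2)) (auto simp: in_prime_factors_iff)
      thus ?thesis using False p by (intro multiplicity_geI) auto
    next
      case False
      thus ?thesis by (simp add: not_dvd_imp_multiplicity_0)
    qed
  qed
qed simp

definition sqrt_roots :: "int \<Rightarrow> int \<Rightarrow> int set" where
  "sqrt_roots D n = {t. 0 \<le> t \<and> t < n \<and> n dvd t ^ 2 - D}"

lemma finite_sqrt_roots: "finite (sqrt_roots D n)"
  by (rule finite_subset[of _ "{0..<n}"]) (auto simp: sqrt_roots_def)

text \<open>By \<open>prime_power_dvd_double_diff_or_sum\<close> a root agrees, up to the factor
  \<open>2\<close>, with \<open>t0\<close> or \<open>- t0\<close> at each prime power of
  \<open>n\<close>; \<open>S\<close> records where it agrees with \<open>t0\<close>.\<close>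

lemma card_sqrt_roots:
  assumes n: "n > 0" and cop: "coprime n D"
  shows "card (sqrt_roots D n) \<le> 2 * 2 ^ card (prime_factors n)"
proof (cases "sqrt_roots D n = {}")
  case False
  then obtain t0 where t0: "t0 \<in> sqrt_roots D n" by blast
  define S where "S = (\<lambda>t. {p \<in> prime_factors n. p ^ multiplicity p n dvd 2 * (t - t0)})"
  define f where "f = (\<lambda>t. (S t, 2 * t < n))"
  \<comment> \<open>Equal \<open>S\<close> gives only \<open>n dvd 2 * (t - t')\<close>, because of the prime \<open>2\<close>; the half of \<open>{0..<n}\<close> decides.\<close>
  have "inj_on f (sqrt_roots D n)"
  proof (rule inj_onI)
    fix t t' assume t: "t \<in> sqrt_roots D n" "t' \<in> sqrt_roots D n" "f t = f t'"
    have "n dvd 2 * (t - t')"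
    proof (rule dvd_if_prime_powers_dvd)
      fix p assume p: "p \<in> prime_factors n"
      define e where "e = multiplicity p n"
      have pp: "prime p" "p dvd n" using p by (auto simp: in_prime_factors_iff)
      have e: "e > 0" using p by (simp add: e_def prime_factors_multiplicity)
      have nD: "\<not> p dvd D" using pp cop by (metis coprime_common_divisor not_prime_unit)
      have pe: "p ^ e dvd n" by (simp add: e_def multiplicity_dvd)
      have sq: "p ^ e dvd x ^ 2 - D" if "x \<in> sqrt_roots D n" for x
        using pe that by (auto simp: sqrt_roots_def)
      have "p ^ e dvd 2 * (t - t')"
      proof (cases "p \<in> S t")
        case True
        hence "p ^ e dvd 2 * (t - t0)" "p ^ e dvd 2 * (t' - t0)" using t(3) by (auto simp: f_def S_def e_def)
        hence "p ^ e dvd 2 * (t - t0) - 2 * (t' - t0)" by (rule dvd_diff)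
        thus ?thesis by (simp add: algebra_simps)
      next
        case False
        hence "\<not> p ^ e dvd 2 * (t - t0)" "\<not> p ^ e dvd 2 * (t' - t0)" using t(3) p by (auto simp: f_def S_def e_def)
        hence "p ^ e dvd 2 * (t + t0)" "p ^ e dvd 2 * (t' + t0)"
          using prime_power_dvd_double_diff_or_sum[OF pp(1) nD e sq sq[OF t0]] t(1,2) by blast+
        hence "p ^ e dvd 2 * (t + t0) - 2 * (t' + t0)" by (rule dvd_diff)
        thus ?thesis by (simp add: algebra_simps)
      qed
      thus "p ^ multiplicity p n dvd 2 * (t - t')" by (simp add: e_def)
    qed (use n in simp)
    moreover have "\<bar>2 * (t - t')\<bar> < n" using t by (auto simp: f_def sqrt_roots_def)
    ultimately have "2 * (t - t') = 0" using zdvd_not_zless[of "\<bar>2 * (t - t')\<bar>" n] by (metis dvd_abs_iff abs_le_zero_iff linorder_not_less)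
    thus "t = t'" by simp
  qed
  moreover have "f ` sqrt_roots D n \<subseteq> Pow (prime_factors n) \<times> UNIV" by (auto simp: f_def S_def)
  ultimately have "card (sqrt_roots D n) \<le> card (Pow (prime_factors n) \<times> (UNIV :: bool set))"
    by (rule card_inj_on_le) simp
  also have "\<dots> = 2 * 2 ^ card (prime_factors n)" by (simp add: card_cartesian_product card_Pow)
  finally show ?thesis .
qed simp

section \<open>Divisors whose square divides \<open>N\<close>\<close>

definition square_divisors :: "int \<Rightarrow> int set" where
  "square_divisors N = {h. h > 0 \<and> h ^ 2 dvd N}"

text \<open>Either \<open>h \<le> q ^ 2\<close>, or the cofactor \<open>N div h ^ 2\<close> is at
  most \<open>q ^ 2\<close>, and the cofactor determines \<open>h\<close>.\<close>

lemma card_square_divisors: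
  fixes q :: real
  assumes "q > 0" "of_int N = q ^ 6"
  shows "finite (square_divisors N)" "card (square_divisors N) \<le> 2 * q ^ 2"
proof -
  define c where "c = \<lfloor>q ^ 2\<rfloor>"
  have N: "N > 0" using assms by (metis of_int_0_less_iff zero_less_power)
  have c: "of_int c \<le> q ^ 2" by (simp add: c_def)
  define g where "g = (\<lambda>h. N div h ^ 2)"
  define H where "H = square_divisors N"
  have gh: "g h * h ^ 2 = N" if "h \<in> H" for h using that by (simp add: H_def square_divisors_def g_def)
  have gpos: "g h > 0" if "h \<in> H" for h
    using gh[OF that] N that by (metis H_def mem_Collect_eq square_divisors_def zero_less_mult_pos2 zero_less_power)
  have sub: "H \<subseteq> {1..c} \<union> {h \<in> H. g h \<in> {1..c}}"
  proof
    fix h assume h: "h \<in> H"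
    have h0: "h > 0" using h by (simp add: H_def square_divisors_def)
    show "h \<in> {1..c} \<union> {h \<in> H. g h \<in> {1..c}}"
    proof (cases "h \<le> c")
      case False
      hence hq: "q ^ 2 \<le> of_int h" unfolding c_def by linarith
      have "of_int (g h) * (q ^ 2) ^ 2 \<le> of_int (g h) * (of_int h) ^ 2"
        using hq assms gpos[OF h] by (intro mult_left_mono power_mono) auto
      also have "\<dots> = of_int N" using gh[OF h] by (metis of_int_mult of_int_power)
      also have "\<dots> = q ^ 2 * (q ^ 2) ^ 2" unfolding assms(2) by (simp flip: power_mult power_add)
      finally have "of_int (g h) \<le> q ^ 2" by (rule mult_right_le_imp_le) (use assms in simp)
      hence "g h \<le> c" unfolding c_def by linarith
      thus ?thesis using h gpos[OF h] by auto
    qed (use h0 in auto)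
  qed
  have inj: "inj_on g {h \<in> H. g h \<in> {1..c}}"
  proof (rule inj_onI, clarify)
    fix x y assume xy: "x \<in> H" "y \<in> H" "g x = g y"
    hence "g x * x ^ 2 = g x * y ^ 2" using gh by metis
    hence "x ^ 2 = y ^ 2" using gpos[OF xy(1)] by simp
    thus "x = y" using xy by (simp add: H_def square_divisors_def power2_eq_iff_nonneg)
  qed
  have fin2: "finite {h \<in> H. g h \<in> {1..c}}"
    by (rule inj_on_finite[OF inj, of "{1..c}"]) auto
  show fin: "finite (square_divisors N)" using finite_subset[OF sub] fin2 by (simp add: H_def)
  have c0: "c \<ge> 0" using assms by (simp add: c_def)
  have "card H \<le> card ({1..c} \<union> {h \<in> H. g h \<in> {1..c}})" using fin2 by (intro card_mono sub) auto
  also have "\<dots> \<le> card {1..c} + card {h \<in> H. g h \<in> {1..c}}" by (rule card_Un_le)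
  also have "card {h \<in> H. g h \<in> {1..c}} \<le> card {1..c}" by (rule card_inj_on_le[OF inj]) auto
  finally have "real (card H) \<le> 2 * of_int c" using c0 by simp
  thus "card (square_divisors N) \<le> 2 * q ^ 2" using c by (simp add: H_def)
qed

section \<open>Labels of solutions\<close>

locale quartic = squarefree_int +
  fixes N :: int
  assumes N0: "N > 0" and cop: "coprime N D"
begin

definition is_sol :: "int \<Rightarrow> int \<Rightarrow> bool" where
  "is_sol X Y \<longleftrightarrow> X > 0 \<and> Y > 0 \<and> X ^ 2 + N = D * Y ^ 4"

definition content :: "int \<Rightarrow> int \<Rightarrow> int" where
  "content X Y = gcd X (Y ^ 2)"

text \<open>This is the quotient of the primitive parts of \<open>X\<close> and
  \<open>Y ^ 2\<close>, taken modulo the cofactor of the squared content.\<close>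

definition root_of :: "int \<Rightarrow> int \<Rightarrow> int" where
  "root_of X Y = (SOME t. t \<in> sqrt_roots D (N div content X Y ^ 2) \<and>
     N div content X Y ^ 2 dvd X div content X Y - t * (Y ^ 2 div content X Y))"

definition size_of :: "int \<Rightarrow> int \<Rightarrow> int" where
  "size_of X Y = \<lfloor>log (fund_unit D) (of_int X + of_int (Y ^ 2) * sqrt (of_int D))\<rfloor>"

text \<open>The modulus \<open>4\<close> is chosen so that for equal labels the quotient of the
  numbers \<open>X + Y\<^sup>2 \<surd>D\<close> is the square of an even power of the fundamental
  unit.\<close>

definition label :: "int \<times> int \<Rightarrow> int \<times> int \<times> int" where
  "label = (\<lambda>(X, Y). (content X Y, root_of X Y, size_of X Y mod 4))"

lemma primitive_part:
  assumes "is_sol X Y"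
  defines "h \<equiv> content X Y"
  obtains A B n where "X = h * A" "Y ^ 2 = h * B" "N = h ^ 2 * n" "h > 0" "n > 0"
    "A ^ 2 + n = D * B ^ 2" "coprime B n" "coprime n D"
    "X div h = A" "Y ^ 2 div h = B" "N div h ^ 2 = n"
proof -
  have sol: "X > 0" "Y > 0" "X ^ 2 + N = D * Y ^ 4" using assms(1) by (auto simp: is_sol_def)
  have h: "h > 0" unfolding h_def content_def using sol by (simp add: gcd_pos_int)
  obtain A B where AB: "X = h * A" "Y ^ 2 = h * B" "coprime A B"
    unfolding h_def content_def using gcd_coprime_exists[of X "Y ^ 2"] sol
    by (metis gcd_eq_0_iff less_irrefl mult.commute)
  define n where "n = D * B ^ 2 - A ^ 2"
  have "N = D * (Y ^ 2) ^ 2 - X ^ 2" using sol(3) by (simp add: algebra_simps flip: power_mult)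
  also have "\<dots> = h ^ 2 * n" unfolding AB n_def by (simp add: algebra_simps power_mult_distrib)
  finally have Nn: "N = h ^ 2 * n" .
  have n: "n > 0" using N0 h Nn by (simp add: zero_less_mult_iff)
  have eq: "A ^ 2 + n = D * B ^ 2" by (simp add: n_def)
  have nD: "coprime n D" using cop unfolding Nn by simp
  have "coprime B n"
  proof (rule coprimeI)
    fix c assume "c dvd B" "c dvd n"
    hence "c dvd D * B ^ 2 - n" by (simp add: power2_eq_square)
    hence "c dvd A ^ 2" using eq by (simp add: algebra_simps n_def)
    moreover have "coprime (A ^ 2) B" using AB(3) by simp
    ultimately show "is_unit c" using \<open>c dvd B\<close> by (metis coprime_common_divisor)
  qed
  thus ?thesis using that AB Nn h n eq nD by simp
qed

lemma root_of:
  assumes "is_sol X Y"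
  shows "root_of X Y \<in> sqrt_roots D (N div content X Y ^ 2)"
    "N div content X Y ^ 2 dvd X div content X Y - root_of X Y * (Y ^ 2 div content X Y)"
proof -
  define h where "h = content X Y"
  obtain A B n where *: "X = h * A" "Y ^ 2 = h * B" "N = h ^ 2 * n" "h > 0" "n > 0"
    "A ^ 2 + n = D * B ^ 2" "coprime B n" "coprime n D"
    "X div h = A" "Y ^ 2 div h = B" "N div h ^ 2 = n"
    using primitive_part[OF assms] unfolding h_def by blast
  obtain x where "[B * x = 1] (mod n)" using cong_solve_coprime_int[OF *(7)] by blast
  define t where "t = (A * x) mod n"
  have "[t * B = A * x * B] (mod n)" unfolding t_def by (intro cong_mult cong_refl) (simp add: cong_def)
  also have "A * x * B = A * (B * x)" by simp
  also have "[A * (B * x) = A * 1] (mod n)" by (intro cong_mult cong_refl) fact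
  finally have tB: "[A = t * B] (mod n)" by (simp add: cong_sym)
  hence 1: "n dvd A - t * B" by (simp add: cong_iff_dvd_diff)
  have "n dvd (t * B) ^ 2 - A ^ 2" using 1 by (simp add: cong_pow cong_sym tB flip: cong_iff_dvd_diff)
  hence "n dvd ((t * B) ^ 2 - A ^ 2) - n" by simp
  also have "((t * B) ^ 2 - A ^ 2) - n = B ^ 2 * (t ^ 2 - D)" using *(6) by (simp add: algebra_simps power_mult_distrib)
  finally have "n dvd t ^ 2 - D" using *(7) by (simp add: coprime_dvd_mult_right_iff coprime_commute)
  hence "t \<in> sqrt_roots D n" using *(5) by (simp add: sqrt_roots_def t_def)
  hence "\<exists>t. t \<in> sqrt_roots D (N div content X Y ^ 2) \<and> N div content X Y ^ 2 dvd X div content X Y - t * (Y ^ 2 div content X Y)"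
    using 1 * unfolding h_def by auto
  from someI_ex[OF this] show "root_of X Y \<in> sqrt_roots D (N div content X Y ^ 2)"
    "N div content X Y ^ 2 dvd X div content X Y - root_of X Y * (Y ^ 2 div content X Y)"
    unfolding root_of_def by blast+
qed

text \<open>Both primitive parts have norm \<open>- n\<close> and satisfy
  \<open>A \<equiv> t B\<close> modulo \<open>n\<close> with the same \<open>t\<close>. Hence
  \<open>n\<close> divides \<open>(A + B \<surd>D) (A' - B' \<surd>D)\<close>, and the quotient by
  \<open>- n\<close> is the unit.\<close>

lemma ratio_unit:
  assumes sol: "is_sol X1 Y1" "is_sol X2 Y2"
    and eq: "content X1 Y1 = content X2 Y2" "root_of X1 Y1 = root_of X2 Y2"
  obtains u where "u \<in> Zsqrt_units D"
    "of_int X1 + of_int (Y1 ^ 2) * sqrt (of_int D) = u * (of_int X2 + of_int (Y2 ^ 2) * sqrt (of_int D))"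
proof -
  define h where "h = content X1 Y1"
  define t where "t = root_of X1 Y1"
  obtain A B n where 1: "X1 = h * A" "Y1 ^ 2 = h * B" "N = h ^ 2 * n" "h > 0" "n > 0"
    "A ^ 2 + n = D * B ^ 2" "coprime B n" "coprime n D"
    "X1 div h = A" "Y1 ^ 2 div h = B" "N div h ^ 2 = n"
    using primitive_part[OF sol(1)] unfolding h_def by blast
  obtain A' B' n' where 2: "X2 = h * A'" "Y2 ^ 2 = h * B'" "N = h ^ 2 * n'" "h > 0" "n' > 0"
    "A' ^ 2 + n' = D * B' ^ 2" "coprime B' n'" "coprime n' D"
    "X2 div h = A'" "Y2 ^ 2 div h = B'" "N div h ^ 2 = n'"
    using primitive_part[OF sol(2)] unfolding h_def eq(1) by blast
  have nn: "n' = n" using 1(11) 2(11) by simp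
  have "n dvd A - t * B" "n dvd t ^ 2 - D"
    using root_of[OF sol(1)] unfolding h_def[symmetric] t_def[symmetric] 1(9-11) by (simp_all add: sqrt_roots_def)
  moreover have "n dvd A' - t * B'"
    using root_of(2)[OF sol(2)] unfolding eq[symmetric] h_def[symmetric] t_def[symmetric] 2(9-11) nn .
  ultimately obtain c d e where cde: "A = t * B + n * c" "A' = t * B' + n * d" "t ^ 2 - D = n * e"
    by (metis dvdE add.commute diff_add_cancel)
  \<comment> \<open>\<open>p\<close> and \<open>q\<close> are the quotients by \<open>- n\<close> of
    \<open>A * A' - D * B * B'\<close> and \<open>B * A' - A * B'\<close>, computed by inserting
    \<open>cde\<close>.\<close>
  define p where "p = - (e * B * B' + t * B * d + t * B' * c + n * c * d)"
  define q where "q = - (B * d - c * B')"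
  have p: "n * p = - (A * A' - D * B * B')"
  proof -
    have "A * A' - D * B * B' = (t ^ 2 - D) * B * B' + n * (t * B * d + t * B' * c + n * c * d)"
      unfolding cde(1,2) by (simp add: algebra_simps power2_eq_square)
    thus ?thesis unfolding cde(3) p_def by (simp add: algebra_simps)
  qed
  have q: "n * q = - (B * A' - A * B')"
    unfolding cde(1,2) q_def by (simp add: algebra_simps)
  have N2: "A' ^ 2 - D * B' ^ 2 = - n" and N1: "A ^ 2 - D * B ^ 2 = - n" using 1(6) 2(6) nn by auto
  have "n ^ 2 * (p ^ 2 - D * q ^ 2) = (n * p) ^ 2 - D * (n * q) ^ 2" by (simp add: algebra_simps power_mult_distrib)
  also have "\<dots> = (A ^ 2 - D * B ^ 2) * (A' ^ 2 - D * B' ^ 2)"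
    unfolding p q by (simp add: algebra_simps power2_eq_square)
  also have "\<dots> = n ^ 2" unfolding N1 N2 by (simp add: power2_eq_square)
  finally have norm: "p ^ 2 - D * q ^ 2 = 1" using 1(5) by simp
  have "n * (p * A' + D * q * B') = (n * p) * A' + D * (n * q) * B'" by (simp add: algebra_simps)
  also have "\<dots> = - (A * (A' ^ 2 - D * B' ^ 2))" unfolding p q by (simp add: algebra_simps power2_eq_square)
  also have "\<dots> = n * A" unfolding N2 by simp
  finally have a: "p * A' + D * q * B' = A" using 1(5) by simp
  have "n * (p * B' + q * A') = (n * p) * B' + (n * q) * A'" by (simp add: algebra_simps)
  also have "\<dots> = - (B * (A' ^ 2 - D * B' ^ 2))" unfolding p q by (simp add: algebra_simps power2_eq_square)
  also have "\<dots> = n * B" unfolding N2 by simp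
  finally have b: "p * B' + q * A' = B" using 1(5) by simp
  define u where "u = of_int p + of_int q * sqrt (of_int D)"
  have "u * (of_int X2 + of_int (Y2 ^ 2) * sqrt (of_int D))
     = of_int (p * X2 + D * q * Y2 ^ 2) + of_int (p * Y2 ^ 2 + q * X2) * sqrt (of_int D)"
    unfolding u_def Zsqrt_mult_eq ..
  also have "p * X2 + D * q * Y2 ^ 2 = X1" unfolding 1(1) 2(1,2) a[symmetric] by (simp add: algebra_simps)
  also have "p * Y2 ^ 2 + q * X2 = Y1 ^ 2" unfolding 1(2) 2(1,2) b[symmetric] by (simp add: algebra_simps)
  finally show ?thesis using that[of u] Zsqrt_unitsI[OF norm] by (simp add: u_def)
qed

lemma is_sol_mono:
  assumes "is_sol X1 Y1" "is_sol X2 Y2" "Y1 < Y2"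
  shows "X1 < X2"
proof -
  have "Y1 ^ 4 < Y2 ^ 4" using assms by (intro power_strict_mono) (auto simp: is_sol_def)
  hence "D * Y1 ^ 4 < D * Y2 ^ 4" using D1 by simp
  hence "X1 ^ 2 < X2 ^ 2" using assms by (simp add: is_sol_def)
  thus ?thesis by (rule power_less_imp_less_base) (use assms in \<open>auto simp: is_sol_def\<close>)
qed

lemma same_label_solution_pair:
  assumes sol: "is_sol X1 Y1" "is_sol X2 Y2" and less: "Y1 < Y2" and large: "N \<le> X1"
    and lab: "label (X1, Y1) = label (X2, Y2)"
  obtains a b where "solution_pair D N X1 Y1 X2 Y2 a b"
proof -
  define e where "e = fund_unit D"
  define \<alpha>1 where "\<alpha>1 = of_int X1 + of_int (Y1 ^ 2) * sqrt (of_int D)"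
  define \<alpha>2 where "\<alpha>2 = of_int X2 + of_int (Y2 ^ 2) * sqrt (of_int D)"
  have pos: "X1 > 0" "Y1 > 0" "X2 > 0" "Y2 > 0" using sol by (auto simp: is_sol_def)
  have "X1 < X2" by (rule is_sol_mono[OF sol less])
  hence X: "real_of_int X1 < of_int X2" by simp
  have "Y1 ^ 2 < Y2 ^ 2" using less pos by (intro power_strict_mono) auto
  hence Y: "real_of_int (Y1 ^ 2) < of_int (Y2 ^ 2)" by (simp only: of_int_less_iff)
  have lt: "\<alpha>1 < \<alpha>2" unfolding \<alpha>1_def \<alpha>2_def using sqrt_D_gt_1
    by (intro add_strict_mono mult_strict_right_mono X Y) simp
  have \<alpha>1: "\<alpha>1 > 0" unfolding \<alpha>1_def using pos sqrt_D_gt_1 by (intro add_pos_pos mult_pos_pos) auto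
  obtain u where u: "u \<in> Zsqrt_units D" "\<alpha>2 = u * \<alpha>1"
    unfolding \<alpha>1_def \<alpha>2_def using ratio_unit[OF sol(2,1)] lab by (auto simp: label_def)
  define j where "j = size_of X2 Y2 - size_of X1 Y1"
  have uj: "u = e powi j" unfolding e_def
    using unit_eq_power[OF u(1) _ \<alpha>1 u(2), of j] lt \<alpha>1 by (auto simp: j_def size_of_def \<alpha>1_def \<alpha>2_def)
  have "u > 1" using u(2) lt \<alpha>1 by (simp add: mult_less_cancel_right1)
  have j0: "j > 0"
  proof (rule ccontr)
    assume "\<not> j > 0"
    hence "e powi j \<le> e powi 0" using fund_unit_least(2) by (intro power_int_increasing) (auto simp: e_def)
    thus False using \<open>u > 1\<close> uj by simp
  qed
  have "4 dvd j" using lab unfolding j_def label_def by (simp add: mod_eq_dvd_iff dvd_diff_commute)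
  then obtain i where i: "j = 4 * i" by (elim dvdE)
  define k where "k = nat i"
  have k: "k > 0" "j = int (4 * k)" using i j0 by (auto simp: k_def)
  \<comment> \<open>\<open>e ^ (2 * k)\<close> has norm \<open>1\<close>, and its square is
    \<open>u\<close>, so it is the unit that \<open>solution_pair\<close> asks for.\<close>
  obtain a b where ab: "e ^ (2 * k) = of_int a + of_int b * sqrt (of_int D)"
    "a > 0" "b > 0" "a ^ 2 - D * b ^ 2 = 1"
    using fund_unit_even_power[OF k(1)] unfolding e_def by blast
  have "u = e ^ (4 * k)" unfolding uj k(2) by (simp only: power_int_of_nat)
  also have "\<dots> = e ^ (2 * k) * e ^ (2 * k)" by (simp flip: power_add)
  also have "\<dots> = of_int (a * a + D * b * b) + of_int (a * b + b * a) * sqrt (of_int D)"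
    unfolding ab(1) Zsqrt_mult_eq ..
  finally have "\<alpha>2 = of_int ((a * a + D * b * b) * X1 + D * (a * b + b * a) * Y1 ^ 2)
     + of_int ((a * a + D * b * b) * Y1 ^ 2 + (a * b + b * a) * X1) * sqrt (of_int D)"
    unfolding u(2) \<alpha>1_def Zsqrt_mult_eq by (simp only:) (simp only: Zsqrt_mult_eq)
  hence X2: "X2 = (a * a + D * b * b) * X1 + D * (a * b + b * a) * Y1 ^ 2"
    unfolding \<alpha>2_def Zsqrt_eq_iff by simp
  have "solution_pair D N X1 Y1 X2 Y2 a b"
  proof
    show "X2 = X1 * (a ^ 2 + D * b ^ 2) + 2 * a * b * D * Y1 ^ 2"
      unfolding X2 by (simp add: algebra_simps power2_eq_square)
  qed (use D1 N0 pos ab sol large in \<open>auto simp: is_sol_def\<close>)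
  thus ?thesis by (rule that)
qed

end

section \<open>Counting solutions\<close>

text \<open>
  The cubic gap is used only through the factor \<open>64\<close> while \<open>x < n\<^sup>2\<close>, which takes at most \<open>J\<close> steps.
  From there on each step at least squares \<open>x\<close>: three squarings reach \<open>2 ^ 96\<close>, and six more
  reach the exponent \<open>64\<close> excluded by the last hypothesis.
\<close>
lemma gap_chain_bound:
  fixes R :: "real set" and n :: real and J :: nat
  assumes n1: "n \<ge> 1" and J: "n \<le> 64 ^ J"
    and base: "\<And>x. x \<in> R \<Longrightarrow> 8192 * n \<le> x"
    and gap: "\<And>x y. x \<in> R \<Longrightarrow> y \<in> R \<Longrightarrow> x < y \<Longrightarrow> x ^ 3 \<le> y * n ^ 2"
    and far: "\<And>x y. x \<in> R \<Longrightarrow> y \<in> R \<Longrightarrow> x < y \<Longrightarrow> n ^ 2 \<le> x \<Longrightarrow> 2 ^ 96 \<le> x \<Longrightarrow> y < x ^ 64"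
  shows "finite R \<and> card R \<le> J + 9"
proof (rule ccontr)
  assume neg: "\<not> ?thesis"
  \<comment> \<open>With \<open>J + 10\<close> members, \<open>J\<close> steps lead from
    \<open>x 0\<close> to \<open>y 0\<close>, and nine more lead to \<open>y 9\<close>.\<close>
  have "\<exists>B. finite B \<and> card B = J + 10 \<and> B \<subseteq> R"
  proof (cases "finite R")
    case True
    hence "J + 10 \<le> card R" using neg by simp
    then obtain B where "B \<subseteq> R" "card B = J + 10" "finite B" by (rule obtain_subset_with_card_n)
    thus ?thesis by blast
  next
    case False
    thus ?thesis by (rule infinite_arbitrarily_large)
  qed
  then obtain B where B: "finite B" "card B = J + 10" "B \<subseteq> R" by blast
  define x where "x = (\<lambda>i. sorted_list_of_set B ! i)"
  have xR: "x i \<in> R" if "i < J + 10" for i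
  proof -
    have "x i \<in> set (sorted_list_of_set B)" unfolding x_def using that B by (intro nth_mem) simp
    thus ?thesis using B by auto
  qed
  have x_less: "x i < x j" if "i < j" "j < J + 10" for i j
    unfolding x_def using sorted_wrt_nth_less[OF strict_sorted_list_of_set[of B] that(1)] that(2) B by simp
  have growth: "8192 * 64 ^ i * n \<le> x i" if "i < J + 10" for i
    using that
  proof (induction i)
    case 0
    thus ?case using base[OF xR[of 0]] by simp
  next
    case (Suc i)
    have i: "i < J + 10" using Suc.prems by simp
    have "x i ^ 3 \<le> x (Suc i) * n ^ 2" using Suc.prems by (intro gap xR x_less) auto
    moreover have "64 * n ^ 2 * x i \<le> x i ^ 3"
    proof -
      have x0: "8 * n \<le> x i" "x i \<ge> 0" using base[OF xR[OF i]] n1 by auto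
      have "(8 * n) ^ 2 \<le> x i ^ 2" using x0 n1 by (intro power_mono) auto
      hence "(8 * n) ^ 2 * x i \<le> x i ^ 2 * x i" using x0(2) by (rule mult_right_mono)
      thus ?thesis by (simp add: power2_eq_square power3_eq_cube)
    qed
    ultimately have "(64 * x i) * n ^ 2 \<le> x (Suc i) * n ^ 2" by (simp add: mult_ac)
    hence "64 * x i \<le> x (Suc i)" using n1 by (simp add: mult_le_cancel_right)
    thus ?case using Suc.IH[OF i] by simp
  qed
  define y where "y = (\<lambda>i. x (J + i))"
  have y0: "8192 \<le> y 0" "n ^ 2 \<le> y 0"
  proof -
    have "8192 * n * n \<le> 8192 * 64 ^ J * n" using J n1 by (intro mult_right_mono mult_left_mono) auto
    hence *: "8192 * n * n \<le> y 0" using growth[of J] by (simp add: y_def)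
    have "1 * 1 \<le> n * n" using n1 by (intro mult_mono) auto
    thus "8192 \<le> y 0" "n ^ 2 \<le> y 0" using * by (simp_all add: power2_eq_square)
  qed
  have y_ge: "y 0 \<le> y i" if "i < 10" for i
    using that x_less[of J "J + i"] by (cases "i = 0") (auto simp: y_def less_imp_le)
  have y_sq: "y i ^ 2 \<le> y (Suc i)" if "i < 9" for i
  proof -
    have yi: "n ^ 2 \<le> y i" "y i > 0" using y0 y_ge[of i] that by auto
    have "y i ^ 2 * n ^ 2 \<le> y i ^ 2 * y i" using yi by (intro mult_left_mono) auto
    also have "\<dots> = y i ^ 3" by (simp add: power2_eq_square power3_eq_cube)
    also have "\<dots> \<le> y (Suc i) * n ^ 2" unfolding y_def using that by (intro gap xR x_less) auto
    finally show ?thesis using n1 by (simp add: mult_le_cancel_right)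
  qed
  have y_pow: "y i ^ (2 ^ k) \<le> y (i + k)" if "i + k < 10" for i k
    using that
  proof (induction k)
    case (Suc k)
    have "y i ^ (2 ^ Suc k) = (y i ^ (2 ^ k)) ^ 2" by (simp add: mult.commute flip: power_mult)
    also have "\<dots> \<le> y (i + k) ^ 2" using Suc y0 y_ge[of i] by (intro power_mono Suc.IH zero_le_power) auto
    also have "\<dots> \<le> y (Suc (i + k))" using Suc.prems by (intro y_sq) auto
    finally show ?case by simp
  qed simp
  have "(2::real) ^ 96 \<le> 8192 ^ 8" by simp
  also have "\<dots> \<le> y 0 ^ 8" using y0 by (intro power_mono) auto
  also have "\<dots> \<le> y 3" using y_pow[of 0 3] by simp
  finally have "2 ^ 96 \<le> y 3" .
  moreover have "n ^ 2 \<le> y 3" using y0 y_ge[of 3] by simp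
  ultimately have "y 9 < y 3 ^ 64" unfolding y_def by (intro far xR x_less) auto
  moreover have "y 3 ^ 64 \<le> y 9" using y_pow[of 3 6] by simp
  ultimately show False by simp
qed

context quartic begin

lemma is_sol_eq: "is_sol X1 Y \<Longrightarrow> is_sol X2 Y \<Longrightarrow> X1 = X2"
proof -
  assume "is_sol X1 Y" "is_sol X2 Y"
  hence "X1 ^ 2 + N = X2 ^ 2 + N" "X1 > 0" "X2 > 0" unfolding is_sol_def by simp_all
  thus ?thesis by (simp add: power2_eq_iff_nonneg)
qed

text \<open>The values \<rho> on a fiber satisfy the hypotheses of \<open>gap_chain_bound\<close>:
  any two of them come from a \<open>solution_pair\<close>, which provides \<open>gap\<close> and
  \<open>far\<close>.\<close>

lemma card_label_fiber:
  fixes l :: "int \<times> int \<times> int" and J :: nat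
  assumes J: "of_int N \<le> (64::real) ^ J"
  defines "F \<equiv> {(X, Y). is_sol X Y \<and> 10000 * N < Y ^ 2 \<and> label (X, Y) = l}"
  shows "finite F \<and> card F \<le> J + 9"
proof -
  define \<rho> where "\<rho> = (\<lambda>(X :: int, Y :: int). sqrt (of_int D) * of_int Y ^ 2)"
  have Y_less: "Y1 < Y2" if "\<rho> (X1, Y1) < \<rho> (X2, Y2)" "Y1 > 0" "Y2 > 0" for X1 Y1 X2 Y2 :: int
  proof (rule ccontr)
    assume "\<not> Y1 < Y2"
    hence "real_of_int Y2 ^ 2 \<le> of_int Y1 ^ 2" using that by (intro power_mono) auto
    hence "\<rho> (X2, Y2) \<le> \<rho> (X1, Y1)" using D1 by (auto simp: \<rho>_def intro!: mult_left_mono)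
    thus False using that by simp
  qed
  have inj: "inj_on \<rho> F"
  proof (rule inj_onI)
    fix a b assume ab: "a \<in> F" "b \<in> F" "\<rho> a = \<rho> b"
    obtain X1 Y1 X2 Y2 where eq: "a = (X1, Y1)" "b = (X2, Y2)" by (cases a, cases b)
    have sol: "is_sol X1 Y1" "is_sol X2 Y2" using ab eq by (auto simp: F_def)
    hence pos: "Y1 > 0" "Y2 > 0" by (auto simp: is_sol_def)
    have "real_of_int Y1 ^ 2 = of_int Y2 ^ 2" using ab(3) D1 by (simp add: \<rho>_def eq)
    hence "Y1 = Y2" using pos by (simp add: power2_eq_iff_nonneg)
    thus "a = b" using is_sol_eq sol eq by simp
  qed
  have pair: "\<exists>X1 Y1 X2 Y2 a b. solution_pair D N X1 Y1 X2 Y2 a b \<and> x = sqrt (of_int D) * of_int Y1 ^ 2 \<and> y = sqrt (of_int D) * of_int Y2 ^ 2"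
    if xy: "x \<in> \<rho> ` F" "y \<in> \<rho> ` F" "x < y" for x y
  proof -
    obtain X1 Y1 X2 Y2 where *: "(X1, Y1) \<in> F" "(X2, Y2) \<in> F" "x = \<rho> (X1, Y1)" "y = \<rho> (X2, Y2)"
      using xy by auto
    have sol: "is_sol X1 Y1" "is_sol X2 Y2" and lab: "label (X1, Y1) = label (X2, Y2)" and big: "10000 * N < Y1 ^ 2"
      using * by (auto simp: F_def)
    have pos: "X1 > 0" "Y1 > 0" "Y2 > 0" using sol by (auto simp: is_sol_def)
    have "N \<le> X1"
    proof -
      \<comment> \<open>The weaker \<open>2 * N \<le> Y1 ^ 2\<close> already gives
        \<open>4 * N ^ 2 \<le> X1 ^ 2 + N\<close>, and \<open>N \<le> N ^ 2\<close> removes the last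
        summand.\<close>
      have "(2 * N) ^ 2 \<le> (Y1 ^ 2) ^ 2" using big N0 by (intro power_mono) auto
      also have "\<dots> \<le> D * (Y1 ^ 2) ^ 2" using D1 mult_right_mono[of 1 D "(Y1 ^ 2) ^ 2"] by simp
      also have "\<dots> = X1 ^ 2 + N" using sol(1) by (simp add: is_sol_def flip: power_mult)
      finally have "4 * N ^ 2 \<le> X1 ^ 2 + N" by (simp add: power_mult_distrib)
      moreover have "N * 1 \<le> N * N" using N0 by (intro mult_left_mono) auto
      ultimately have "N ^ 2 \<le> X1 ^ 2" using N0 unfolding power2_eq_square by linarith
      thus ?thesis using pos by (simp add: power2_le_iff_abs_le)
    qed
    moreover have "Y1 < Y2" using Y_less[of X1 Y1 X2 Y2] xy(3) * pos by simp
    ultimately obtain a b where "solution_pair D N X1 Y1 X2 Y2 a b"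
      using same_label_solution_pair[OF sol _ _ lab] by blast
    thus ?thesis using *(3,4) unfolding \<rho>_def prod.case by blast
  qed
  have "finite (\<rho> ` F) \<and> card (\<rho> ` F) \<le> J + 9"
  proof (rule gap_chain_bound[of "of_int N"])
    show "real_of_int N \<ge> 1" using N0 by simp
    show "real_of_int N \<le> 64 ^ J" by (rule J)
  next
    fix x assume "x \<in> \<rho> ` F"
    then obtain X Y where *: "10000 * N < Y ^ 2" "x = sqrt (of_int D) * of_int Y ^ 2" by (auto simp: F_def \<rho>_def)
    have "8192 * real_of_int N \<le> of_int (Y ^ 2)" using *(1) N0 by linarith
    also have "1 * of_int (Y ^ 2) \<le> sqrt (of_int D) * of_int (Y ^ 2)"
      using sqrt_D_gt_1 by (intro mult_right_mono) auto
    finally show "8192 * of_int N \<le> x" using *(2) by simp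
  next
    fix x y assume xy: "x \<in> \<rho> ` F" "y \<in> \<rho> ` F" "x < y"
    obtain X1 Y1 X2 Y2 a b where *: "solution_pair D N X1 Y1 X2 Y2 a b"
      "x = sqrt (of_int D) * of_int Y1 ^ 2" "y = sqrt (of_int D) * of_int Y2 ^ 2"
      using pair[OF xy] by blast
    interpret solution_pair D N X1 Y1 X2 Y2 a b by (rule *(1))
    have e: "x = \<rho>1" "y = \<rho>2" using * by (simp_all add: \<rho>1_def \<rho>2_def)
    show "x ^ 3 \<le> y * (of_int N) ^ 2" unfolding e by (rule gap)
    show "y < x ^ 64" if "(of_int N) ^ 2 \<le> x" "2 ^ 96 \<le> x"
      using that unfolding e by (rule far)
  qed
  thus ?thesis using inj by (auto simp: card_image finite_image_iff)
qed

lemma card_small_solutions: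
  defines "S \<equiv> {(X, Y). is_sol X Y \<and> Y ^ 2 \<le> 10000 * N}"
  shows "finite S" "card S \<le> 100 * sqrt (of_int N)"
proof -
  define c where "c = \<lfloor>100 * sqrt (of_int N)\<rfloor>"
  have c0: "c \<ge> 0" using N0 by (simp add: c_def)
  have inj: "inj_on snd S" by (rule inj_onI) (auto simp: S_def intro: is_sol_eq)
  have sub: "snd ` S \<subseteq> {1..c}"
  proof clarify
    fix X Y assume "(X, Y) \<in> S"
    hence Y: "Y > 0" "Y ^ 2 \<le> 10000 * N" by (auto simp: S_def is_sol_def)
    have "real_of_int (Y ^ 2) \<le> of_int (10000 * N)" using Y(2) by (simp only: of_int_le_iff)
    hence "(real_of_int Y) ^ 2 \<le> (100 * sqrt (of_int N)) ^ 2" using N0 by (simp add: power_mult_distrib)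
    hence "real_of_int Y \<le> 100 * sqrt (of_int N)" by (rule power2_le_imp_le) (use N0 in simp)
    hence "Y \<le> c" unfolding c_def by linarith
    thus "snd (X, Y) \<in> {1..c}" using Y by simp
  qed
  show "finite S" using inj sub by (rule inj_on_finite) simp
  have "card S \<le> card {1..c}" using inj sub by (rule card_inj_on_le) simp
  hence "real (card S) \<le> of_int c" using c0 by simp
  thus "card S \<le> 100 * sqrt (of_int N)" unfolding c_def by linarith
qed

section \<open>The number of labels and the final count\<close>

definition labels :: "(int \<times> int \<times> int) set" where
  "labels = (SIGMA h:square_divisors N. sqrt_roots D (N div h ^ 2) \<times> {0..3})"

lemma label_in_labels:
  assumes "is_sol X Y" shows "label (X, Y) \<in> labels"
proof -
  define h where "h = content X Y"
  obtain A B n where "N = h ^ 2 * n" "h > 0"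
    using primitive_part[OF assms] unfolding h_def by metis
  hence "content X Y \<in> square_divisors N" by (simp add: square_divisors_def h_def)
  moreover have "size_of X Y mod 4 \<in> {0..3}" using pos_mod_bound[of 4 "size_of X Y"] pos_mod_sign[of 4 "size_of X Y"] by simp
  ultimately show ?thesis using root_of(1)[OF assms] by (simp add: labels_def label_def)
qed

text \<open>The constant is \<open>2 * 2 * 4\<close>, from contents, roots and exponents modulo
  \<open>4\<close>. The cofactor \<open>N div h ^ 2\<close> has no more prime factors than
  \<open>N\<close>.\<close>

lemma card_labels:
  fixes q :: real
  assumes q: "q > 0" "of_int N = q ^ 6"
  shows "finite labels" "card labels \<le> 16 * 2 ^ omega N * q ^ 2"
proof -
  note sd = card_square_divisors[OF q]
  show "finite labels" unfolding labels_def using sd(1) finite_sqrt_roots by (intro finite_SigmaI) auto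
  have roots: "card (sqrt_roots D (N div h ^ 2)) \<le> 2 * 2 ^ omega N" if h: "h \<in> square_divisors N" for h
  proof -
    define n where "n = N div h ^ 2"
    have h0: "h > 0" and N: "N = h ^ 2 * n" using h by (auto simp: square_divisors_def n_def)
    have n: "n > 0" using N0 N h0 by (simp add: zero_less_mult_iff)
    have "coprime n D" using cop unfolding N by simp
    hence "card (sqrt_roots D n) \<le> 2 * 2 ^ card (prime_factors n)" by (rule card_sqrt_roots[OF n])
    also have "card (prime_factors n) \<le> omega N" unfolding omega_def
      using N N0 by (intro card_mono dvd_prime_factors) auto
    hence "(2::nat) * 2 ^ card (prime_factors n) \<le> 2 * 2 ^ omega N" by (intro mult_left_mono power_increasing) auto
    finally show ?thesis by (simp add: n_def)
  qed
  have "card labels = (\<Sum>h\<in>square_divisors N. card (sqrt_roots D (N div h ^ 2) \<times> {0..3::int}))"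
    unfolding labels_def using sd(1) finite_sqrt_roots by (subst card_SigmaI) auto
  also have "\<dots> \<le> (\<Sum>h\<in>square_divisors N. 2 * 2 ^ omega N * 4)"
    by (intro sum_mono) (use roots in \<open>auto simp: card_cartesian_product\<close>)
  also have "\<dots> = card (square_divisors N) * (8 * 2 ^ omega N)" by simp
  finally have "real (card labels) \<le> real (card (square_divisors N) * (8 * 2 ^ omega N))"
    by (simp only: of_nat_le_iff)
  also have "\<dots> = real (card (square_divisors N)) * (8 * 2 ^ omega N)" by simp
  also have "\<dots> \<le> 2 * q ^ 2 * (8 * 2 ^ omega N)" using sd(2) by (intro mult_right_mono) auto
  finally show "card labels \<le> 16 * 2 ^ omega N * q ^ 2" by (simp add: mult_ac)
qed

lemma card_solutions:
  shows "finite {(X, Y). is_sol X Y} \<and> card {(X, Y). is_sol X Y} \<le> 384 * 2 ^ omega N * sqrt (of_int N)"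
proof -
  define q where "q = root 6 (of_int N)"
  have q6: "of_int N = q ^ 6" using N0 by (simp add: q_def)
  have q1: "q \<ge> 1" using N0 by (simp add: q_def)
  have q3: "sqrt (of_int N) = q ^ 3" unfolding q6 using q1 by (intro real_sqrt_unique) (simp_all flip: power_mult)
  \<comment> \<open>Since \<open>q \<le> 2 ^ J\<close>, this \<open>J\<close> satisfies
    \<open>N = q ^ 6 \<le> 64 ^ J\<close>; a length linear in \<open>q\<close> suffices, so no
    logarithm appears.\<close>
  define J where "J = nat \<lceil>q\<rceil>"
  have J: "real J \<le> q + 1" "q \<le> real J" using q1 by (auto simp: J_def)
  have NJ: "of_int N \<le> (64::real) ^ J"
  proof -
    have "q \<le> 2 ^ J" using J(2) of_nat_less_two_power[of J, where 'a = real] by linarith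
    hence "q ^ 6 \<le> (2 ^ J) ^ 6" using q1 by (intro power_mono) auto
    also have "\<dots> = (2 ^ 6) ^ J" by (simp only: power_mult[symmetric] mult.commute)
    finally show ?thesis unfolding q6 by simp
  qed
  define S where "S = {(X, Y). is_sol X Y \<and> Y ^ 2 \<le> 10000 * N}"
  define F where "F = (\<lambda>l. {(X, Y). is_sol X Y \<and> 10000 * N < Y ^ 2 \<and> label (X, Y) = l})"
  note small = card_small_solutions[folded S_def]
  have F: "finite (F l)" "card (F l) \<le> J + 9" for l
    using card_label_fiber[OF NJ, of l] by (auto simp: F_def)
  note lab = card_labels[OF _ q6]
  have split: "{(X, Y). is_sol X Y} = S \<union> (\<Union>l\<in>labels. F l)"
    using label_in_labels by (auto simp: S_def F_def not_less)
  have fin: "finite (\<Union>l\<in>labels. F l)" using lab(1) q1 F(1) by auto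
  have "card {(X, Y). is_sol X Y} \<le> card S + card (\<Union>l\<in>labels. F l)" unfolding split by (rule card_Un_le)
  also have "card (\<Union>l\<in>labels. F l) \<le> (\<Sum>l\<in>labels. card (F l))" using lab(1) q1 by (intro card_UN_le) auto
  also have "\<dots> \<le> (\<Sum>l\<in>labels. J + 9)" by (intro sum_mono F)
  also have "\<dots> = card labels * (J + 9)" by simp
  finally have "card {(X, Y). is_sol X Y} \<le> card S + card labels * (J + 9)" by simp
  hence "real (card {(X, Y). is_sol X Y}) \<le> real (card S + card labels * (J + 9))" by (simp only: of_nat_le_iff)
  also have "\<dots> = real (card S) + real (card labels) * (real J + 9)" by simp
  \<comment> \<open>\<open>J + 9 \<le> q + 10 \<le> 11 * q\<close>, and
    \<open>16 * 11 = 176\<close>. The remaining \<open>384 - 176 = 208\<close> covers the small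
    solutions.\<close>
  also have "\<dots> \<le> 100 * q ^ 3 + 16 * 2 ^ omega N * q ^ 2 * (11 * q)"
    using small(2) lab(2) q1 J(1) unfolding q3 by (intro add_mono mult_mono) auto
  also have "\<dots> = 100 * q ^ 3 + 176 * 2 ^ omega N * q ^ 3"
    by (simp add: power2_eq_square power3_eq_cube)
  also have "\<dots> \<le> 208 * 2 ^ omega N * q ^ 3 + 176 * 2 ^ omega N * q ^ 3"
  proof (intro add_right_mono mult_right_mono)
    have "(1::real) \<le> 2 ^ omega N" by simp
    thus "(100::real) \<le> 208 * 2 ^ omega N" by linarith
  qed (use q1 in auto)
  also have "\<dots> = 384 * 2 ^ omega N * sqrt (of_int N)" unfolding q3 by (simp add: algebra_simps)
  finally have "real (card {(X, Y). is_sol X Y}) \<le> 384 * 2 ^ omega N * sqrt (of_int N)" .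
  moreover have "finite {(X, Y). is_sol X Y}" unfolding split using small(1) fin by simp
  ultimately show ?thesis by simp
qed

text \<open>The bound \<open>1 + \<surd>D\<close> is at least \<open>2\<close> and at least
  \<open>\<surd>D\<close>, so the cube of the fundamental unit is at least
  \<open>2 * D\<close>.\<close>

lemma fund_unit_powr_ge: "fund_unit D powr (3 / 2) \<ge> sqrt (2 * of_int D)"
proof -
  define e where "e = fund_unit D"
  have e: "e > 0" "e \<ge> 1 + sqrt (of_int D)" using fund_unit_least(2) fund_unit_ge by (auto simp: e_def)
  have "2 \<le> e" "sqrt (of_int D) \<le> e" using e(2) sqrt_D_gt_1 by linarith+
  moreover have "2 * of_int D = 2 * (sqrt (of_int D) * sqrt (of_int D))" by (simp only: sqrt_D_sq)
  moreover have "2 * (sqrt (of_int D) * sqrt (of_int D)) \<le> e * (e * e)"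
    using calculation e(1) sqrt_D_gt_1 by (intro mult_mono) auto
  ultimately have "2 * of_int D \<le> e * (e * e)" by linarith
  also have "\<dots> = (e powr (3 / 2)) ^ 2"
  proof -
    have "(e powr (3 / 2)) ^ 2 = e powr 3" by (simp add: power2_eq_square flip: powr_add)
    also have "\<dots> = e * (e * e)" using e(1) by (simp add: power3_eq_cube)
    finally show ?thesis by simp
  qed
  finally show ?thesis using e unfolding e_def by (intro real_le_lsqrt) auto
qed

end

theorem theorem1p1:
  fixes D k :: int
  assumes "D > 1" and "squarefree D" and "k < 0" and "coprime k D"
  shows "finite {(X :: int, Y :: int). X > 0 \<and> Y > 0 \<and> X ^ 2 - D * Y ^ 4 = k} \<and>
         real (card {(X :: int, Y :: int). X > 0 \<and> Y > 0 \<and> X ^ 2 - D * Y ^ 4 = k})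
           \<le> 384 * 2 ^ omega k * fund_unit D powr (3 / 2)
               * sqrt (of_int \<bar>k\<bar> / (2 * of_int D))"
proof -
  define N where "N = - k"
  interpret quartic D N by standard (use assms in \<open>auto simp: N_def\<close>)
  have set_eq: "{(X :: int, Y :: int). X > 0 \<and> Y > 0 \<and> X ^ 2 - D * Y ^ 4 = k} = {(X, Y). is_sol X Y}"
    unfolding is_sol_def by (auto simp: N_def)
  have om: "omega N = omega k"
    using assms(3) by (auto simp: omega_def N_def in_prime_factors_iff intro!: arg_cong[of _ _ card])
  \<comment> \<open>The factor \<open>sqrt (2 * D)\<close> is split off so that the power of the
    fundamental unit can replace it.\<close>
  have "384 * 2 ^ omega N * sqrt (of_int N)
      = 384 * 2 ^ omega k * (sqrt (2 * of_int D) * sqrt (of_int \<bar>k\<bar> / (2 * of_int D)))"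
    unfolding om real_sqrt_mult[symmetric] using D1 assms(3) by (simp add: N_def)
  also have "\<dots> \<le> 384 * 2 ^ omega k * (fund_unit D powr (3 / 2) * sqrt (of_int \<bar>k\<bar> / (2 * of_int D)))"
    by (intro mult_left_mono mult_right_mono fund_unit_powr_ge) (use D1 in auto)
  finally show ?thesis unfolding set_eq using card_solutions by (simp add: mult.assoc)
qed

end
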